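(* Assume that one of the following holds: (A) $\mathbf{x}$ is a random variable with values in $[0,\infty)$ whose law does not depend on $n$, with finite positive variance and $\mathbb{E}|\mathbf{x}|^4<\infty$; (B) $\mathbf{x}=\epsilon(n)\mathbf{y}$, where $\mathbf{y}$ is a non-negative bounded random variable with law independent of $n$, $\epsilon(n)$ is a Bernoulli random variable independent of $\mathbf{y}$ with parameter $p(n)$ satisfying $p(n)\to0$ and $np(n)\to\infty$, and $\lim_{n\to\infty}n\sigma^2/\log(n)=+\infty$. Here $m=m(n)$ and $\sigma^2=\sigma^2(n)$ are the mean and variance of $\mathbf{x}$. Then, almost surely for $n\gg1$, the Markov generator $L$ is irreducible, and its invariant measure $\Pi$ satisfies $$\|\Pi-U_n\|_{\mathrm{TV}}=\mathcal{O}\left(\frac{\sigma}{m}\sqrt{\frac{\log(n)}{n}}\right)+\mathcal{O}\left(\frac{\sqrt\sigma}{m}\frac{\log(n)}{n^{3/4}}\right),$$ where $U_n=\frac1n(1,\dots,1)^\top$ is the uniform probability distribution on $\{1,\dots,n\}$.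
   Context: For each integer $n\ge1$, $X=(X_{ij})_{1\le i,j\le n}$ is the $n\times n$ random matrix whose entries are i.i.d. copies of $\mathbf{x}$; all random variables (for all $n$) are defined on a common probability space. $D$ is the $n\times n$ diagonal matrix with $D_{ii}=\sum_{k=1}^nX_{ik}$ and $L=X-D$, which is the infinitesimal generator of a continuous time Markov process on $\{1,\dots,n\}$. When $L$ is irreducible, its invariant measure is the unique vector $\Pi\in(0,1)^n$ with $L^\top\Pi=0$ and $\sum_{i=1}^n\Pi_i=1$. For $Q\in\mathbb{R}^n$, $\|Q\|_{\mathrm{TV}}:=\frac12\sum_{i=1}^n|Q_i|$ is the total variation norm. "Almost surely for $n\gg1$" means: almost surely, for all $n$ large enough; $\mathcal{O}(\cdot)$ refers to $n\to\infty$. *)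

theory Defs
  imports "HOL-Probability.Probability" "HOL-Library.Landau_Symbols" "Jordan_Normal_Form.Matrix"
begin

no_notation vec_nth (infixl \<open>$\<close> 90)

(* Matrix and vector indices run over {0..<n} in place of {1,...,n}. *)

definition row_sum_diag :: "real mat \<Rightarrow> real mat" where
  "row_sum_diag A = mat (dim_row A) (dim_row A)
     (\<lambda>(i, j). if i = j then \<Sum>k<dim_col A. A $$ (i, k) else 0)"

definition markov_generator :: "real mat \<Rightarrow> real mat" where
  "markov_generator A = A - row_sum_diag A"

definition jump_rel :: "real mat \<Rightarrow> (nat \<times> nat) set" where
  "jump_rel L = {(i, j). i < dim_row L \<and> j < dim_row L \<and> i \<noteq> j \<and> L $$ (i, j) > 0}"

(* The chain with rates L(i,j), i distinct from j, can go from any state to any other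
   state through finitely many jumps of positive rate. *)
definition irreducible_generator :: "real mat \<Rightarrow> bool" where
  "irreducible_generator L \<longleftrightarrow> (\<forall>i<dim_row L. \<forall>j<dim_row L. (i, j) \<in> (jump_rel L)\<^sup>*)"

definition is_invariant_measure :: "real mat \<Rightarrow> real vec \<Rightarrow> bool" where
  "is_invariant_measure L P \<longleftrightarrow>
     P \<in> carrier_vec (dim_row L) \<and>
     (\<forall>i<dim_row L. 0 < P $ i \<and> P $ i < 1) \<and>
     transpose_mat L *\<^sub>v P = 0\<^sub>v (dim_col L) \<and>
     (\<Sum>i<dim_row L. P $ i) = 1"

(* Only meaningful when exactly one such vector exists. *)
definition invariant_measure :: "real mat \<Rightarrow> real vec" where
  "invariant_measure L = (THE P. is_invariant_measure L P)"

definition tv_norm :: "real vec \<Rightarrow> real" where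
  "tv_norm Q = (1 / 2) * (\<Sum>i<dim_vec Q. \<bar>Q $ i\<bar>)"

definition uniform_vec :: "nat \<Rightarrow> real vec" where
  "uniform_vec n = vec n (\<lambda>_. 1 / real n)"

definition mean :: "'b measure \<Rightarrow> ('b \<Rightarrow> real) \<Rightarrow> real" where
  "mean N x = prob_space.expectation N x"

definition std_dev :: "'b measure \<Rightarrow> ('b \<Rightarrow> real) \<Rightarrow> real" where
  "std_dev N x = sqrt (prob_space.variance N x)"

(* Finiteness of the fourth moment entails finiteness of the variance. *)
definition fixed_law_case :: "'b measure \<Rightarrow> (nat \<Rightarrow> 'b \<Rightarrow> real) \<Rightarrow> bool" where
  "fixed_law_case N x \<longleftrightarrow>
     (\<forall>n\<ge>1. distr N borel (x n) = distr N borel (x 1)) \<and>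
     (\<forall>n\<ge>1. (AE w in N. 0 \<le> x n w) \<and>
        integrable N (\<lambda>w. \<bar>x n w\<bar> ^ 4) \<and>
        prob_space.variance N (x n) > 0)"

(* eps n is a 0/1-valued real variable. A single y for all n is no restriction, because only
   the law of each x n matters. *)
definition sparse_case :: "'b measure \<Rightarrow> (nat \<Rightarrow> 'b \<Rightarrow> real) \<Rightarrow> bool" where
  "sparse_case N x \<longleftrightarrow>
     (\<exists>eps :: nat \<Rightarrow> 'b \<Rightarrow> real. \<exists>y :: 'b \<Rightarrow> real. \<exists>p :: nat \<Rightarrow> real.
        (\<forall>n\<ge>1. \<forall>w\<in>space N. x n w = eps n w * y w) \<and>
        y \<in> borel_measurable N \<and>
        (AE w in N. 0 \<le> y w) \<and> (\<exists>B. AE w in N. y w \<le> B) \<and>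
        (\<forall>n\<ge>1. 0 \<le> p n \<and> p n \<le> 1 \<and>
           eps n \<in> borel_measurable N \<and>
           distr N borel (eps n) = distr (measure_pmf (bernoulli_pmf (p n))) borel of_bool \<and>
           prob_space.indep_var N borel (eps n) borel y) \<and>
        p \<longlonglongrightarrow> 0 \<and>
        filterlim (\<lambda>n. real n * p n) at_top sequentially \<and>
        filterlim (\<lambda>n. real n * (std_dev N (x n))\<^sup>2 / ln (real n)) at_top sequentially)"

end

theory Submission
  imports Defs "Jordan_Normal_Form.Determinant" "HOL-Real_Asymp.Real_Asymp"
begin

text \<open>
  Write \<open>\<delta> = \<Pi> - U\<close>, and let \<open>R\<close> and \<open>C\<close> be the row and column sums of \<open>X\<close>. Then \<open>\<delta> L = - U L\<close>, where
  \<open>U L = (C - R) / n\<close>, and the quadratic form of \<open>- L\<close> at \<open>\<delta>\<close> is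
  \<open>1/2 \<Sum> X i j (\<delta> i - \<delta> j)^2 - 1/2 \<Sum> (\<delta> j)^2 (C j - R j)\<close>. No operator norm bound is needed to control
  it from below: truncated at a suitable level, the weights \<open>X\<close> have all directed cuts of size at least
  \<open>m/4\<close> times the number of pairs and all row and column sums at most \<open>2 n m\<close>, by exponential tail bounds
  and a union bound over all vertex sets, so Cheeger's inequality yields a Poincare inequality with constant
  of order \<open>n m\<close>. Since \<open>C j - R j\<close> is at most a small multiple of \<open>n m\<close>, it follows that
  the Euclidean norm of \<open>\<delta>\<close> is \<open>O(1 / (n m))\<close> times that of \<open>U L\<close>. The sum of the
  \<open>(C j - R j)^2\<close> is \<open>O(n^2 \<sigma>^2 log n)\<close> outside an event of probability \<open>O(1 / (n (log n)^2))\<close> by Chebyshev's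
  inequality, and Cauchy-Schwarz and Borel-Cantelli conclude. The second error term of the theorem is
  thereby seen to be superfluous.
\<close>

section \<open>Cheeger's inequality for weighted directed graphs\<close>

text \<open>The obstacle is that a fixed law has only four moments. The fourth moment bounds the
  probability of one large column sum by order \<open>n^-2\<close>, and a union over
  \<open>n\<close> columns is then not summable. Entries are therefore split at a level
  \<open>t\<close>. The truncated part has exponential tails and carries cuts and row and column
  sums; lowering weights only lowers the Dirichlet form, so its Poincare inequality passes to
  \<open>X\<close>. The excess enters only in upper bounds for column sums. At
  \<open>t = sqrt n\<close> its variance is \<open>O(1 / n)\<close>, which improves
  \<open>n^-2\<close> to \<open>n^-3\<close>.

  The logarithm in the rate is the price of an almost sure statement: it comes from the deviation
  allowed to the sum of squares, not from the gap, which has order \<open>n m\<close> with no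
  logarithmic loss.

  Both families of laws are reduced to one list of moment inequalities,
  \<open>regular_array\<close>, whose constant \<open>C\<close> must not depend on
  \<open>n\<close>.\<close>

text \<open>Peeling off the lowest positive level set of \<open>u\<close> gives an induction on the size of its support.\<close>

lemma coarea_lower_bound:
  fixes Y :: "'v \<Rightarrow> 'v \<Rightarrow> real" and u :: "'v \<Rightarrow> real"
  assumes V: "finite V"
    and cut: "\<And>S. S \<subseteq> V \<Longrightarrow> S \<noteq> {} \<Longrightarrow> 2 * card S \<le> card V \<Longrightarrow>
               h * real (card S) \<le> (\<Sum>i\<in>S. \<Sum>j\<in>V - S. Y i j)"
    and u0: "\<And>i. i \<in> V \<Longrightarrow> 0 \<le> u i"
    and supp: "2 * card {i\<in>V. u i > 0} \<le> card V"
  shows "h * (\<Sum>i\<in>V. u i) \<le> (\<Sum>i\<in>V. \<Sum>j\<in>V. Y i j * max 0 (u i - u j))"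
  using u0 supp
proof (induction "card {i\<in>V. u i > 0}" arbitrary: u rule: less_induct)
  case (less u)
  define S where "S = {i\<in>V. u i > 0}"
  have S: "S \<subseteq> V" "finite S" using V by (auto simp: S_def)
  show ?case
  proof (cases "S = {}")
    case True
    then have "u i = 0" if "i \<in> V" for i
      using less.prems(1)[OF that] that unfolding S_def by force
    then show ?thesis by simp
  next
    case False
    define a where "a = Min (u ` S)"
    have a_in: "a \<in> u ` S" unfolding a_def using False S by (intro Min_in) auto
    have a_le: "a \<le> u i" if "i \<in> S" for i unfolding a_def using that S by (intro Min_le) auto
    have a0: "a > 0" using a_in unfolding S_def by auto
    define v where "v = (\<lambda>i. if i \<in> S then u i - a else u i)"
    have u_off: "u i = 0" if "i \<in> V - S" for i
      using less.prems(1)[of i] that unfolding S_def by force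
    have v0: "0 \<le> v i" if "i \<in> V" for i using a_le u_off that by (auto simp: v_def)
    obtain i0 where i0: "i0 \<in> S" "u i0 = a" using a_in by auto
    have "{i\<in>V. v i > 0} \<subset> S"
    proof (intro psubsetI subsetI)
      fix i assume "i \<in> {i\<in>V. v i > 0}" then show "i \<in> S" using u_off[of i] by (auto simp: v_def split: if_splits)
    next
      show "{i\<in>V. v i > 0} \<noteq> S" using i0 by (auto simp: v_def)
    qed
    then have lt: "card {i\<in>V. v i > 0} < card S" using S by (intro psubset_card_mono) auto
    have IH: "h * (\<Sum>i\<in>V. v i) \<le> (\<Sum>i\<in>V. \<Sum>j\<in>V. Y i j * max 0 (v i - v j))"
      using less.hyps[of v] lt v0 less.prems(2) unfolding S_def by auto
    have cutS: "a * (h * real (card S)) \<le> a * (\<Sum>i\<in>S. \<Sum>j\<in>V - S. Y i j)"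
      using a0 less.prems(2) False S(1) by (intro mult_left_mono cut) (auto simp: S_def)
    have su: "(\<Sum>i\<in>V. u i) = (\<Sum>i\<in>V. v i) + a * real (card S)"
    proof -
      have "(\<Sum>i\<in>V. u i) = (\<Sum>i\<in>V. v i + (if i \<in> S then a else 0))"
        by (intro sum.cong) (auto simp: v_def)
      also have "\<dots> = (\<Sum>i\<in>V. v i) + a * real (card S)"
        using S V by (simp add: sum.distrib sum.If_cases Int_absorb1)
      finally show ?thesis .
    qed
    have "(\<Sum>i\<in>V. \<Sum>j\<in>V. Y i j * max 0 (u i - u j)) =
          (\<Sum>i\<in>V. \<Sum>j\<in>V. Y i j * max 0 (v i - v j) + (if i \<in> S then if j \<in> V - S then a * Y i j else 0 else 0))"
    proof (intro sum.cong refl)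
      fix i j assume ij: "i \<in> V" "j \<in> V"
      \<comment> \<open>Lowering \<open>u\<close> by \<open>a\<close> on \<open>S\<close> leaves
        differences inside \<open>S\<close> alone. From outside \<open>S\<close> into
        \<open>S\<close> both positive parts vanish. Only pairs leaving \<open>S\<close> lose
        \<open>a\<close>, and their total weight is the cut of \<open>S\<close>.\<close>
      have "max 0 (u i - u j) = max 0 (v i - v j) + (if i \<in> S then if j \<in> V - S then a else 0 else 0)"
        using u_off[of i] u_off[of j] a_le[of i] a_le[of j] a0 ij by (auto simp: v_def max_def)
      then show "Y i j * max 0 (u i - u j) = Y i j * max 0 (v i - v j) +
          (if i \<in> S then if j \<in> V - S then a * Y i j else 0 else 0)"
        by (simp add: algebra_simps)
    qed
    also have "\<dots> = (\<Sum>i\<in>V. \<Sum>j\<in>V. Y i j * max 0 (v i - v j)) + a * (\<Sum>i\<in>S. \<Sum>j\<in>V - S. Y i j)"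
    proof -
      have "(\<Sum>j\<in>V. if i \<in> S then if j \<in> V - S then a * Y i j else 0 else 0) =
            (if i \<in> S then \<Sum>j\<in>V - S. a * Y i j else 0)" for i
        using V by (auto simp: sum.If_cases Int_absorb1 Diff_subset sum.inter_restrict[symmetric] simp del: Diff_iff)
      then have "(\<Sum>i\<in>V. \<Sum>j\<in>V. if i \<in> S then if j \<in> V - S then a * Y i j else 0 else 0) =
          (\<Sum>i\<in>V. if i \<in> S then \<Sum>j\<in>V - S. a * Y i j else 0)" by simp
      also have "\<dots> = (\<Sum>i\<in>S. \<Sum>j\<in>V - S. a * Y i j)"
        using V S by (simp add: sum.If_cases Int_absorb1)
      finally show ?thesis by (simp add: sum.distrib sum_distrib_left)
    qed
    finally show ?thesis using IH cutS su by (simp add: algebra_simps)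
  qed
qed

text \<open>The coarea bound is applied to the squares of \<open>g\<close>, whose differences factor
  as \<open>(g i - g j) * (g i + g j)\<close>. The first factor yields the Dirichlet form; the
  second is paid for by the row and column sums.\<close>

lemma poincare_half_support:
  fixes Y :: "'v \<Rightarrow> 'v \<Rightarrow> real" and g :: "'v \<Rightarrow> real"
  assumes V: "finite V" and h: "h > 0" and C: "C > 0"
    and Y0: "\<And>i j. i \<in> V \<Longrightarrow> j \<in> V \<Longrightarrow> 0 \<le> Y i j"
    and cut: "\<And>S. S \<subseteq> V \<Longrightarrow> S \<noteq> {} \<Longrightarrow> 2 * card S \<le> card V \<Longrightarrow>
               h * real (card S) \<le> (\<Sum>i\<in>S. \<Sum>j\<in>V - S. Y i j)"
    and row: "\<And>i. i \<in> V \<Longrightarrow> (\<Sum>j\<in>V. Y i j) \<le> C"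
    and col: "\<And>j. j \<in> V \<Longrightarrow> (\<Sum>i\<in>V. Y i j) \<le> C"
    and g0: "\<And>i. i \<in> V \<Longrightarrow> 0 \<le> g i"
    and supp: "2 * card {i\<in>V. g i > 0} \<le> card V"
  shows "h\<^sup>2 * (\<Sum>i\<in>V. (g i)\<^sup>2) \<le> 4 * C * (\<Sum>i\<in>V. \<Sum>j\<in>V. Y i j * (g i - g j)\<^sup>2)"
proof -
  define G where "G = (\<Sum>i\<in>V. (g i)\<^sup>2)"
  define E where "E = (\<Sum>i\<in>V. \<Sum>j\<in>V. Y i j * (g i - g j)\<^sup>2)"
  define a where "a = h / (4 * C)"
  have a: "a > 0" using h C by (simp add: a_def)
  have "{i\<in>V. (g i)\<^sup>2 > 0} = {i\<in>V. g i > 0}" using g0 by force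
  then have "h * G \<le> (\<Sum>i\<in>V. \<Sum>j\<in>V. Y i j * max 0 ((g i)\<^sup>2 - (g j)\<^sup>2))"
    unfolding G_def using supp by (intro coarea_lower_bound V cut) auto
  also have "\<dots> \<le> (\<Sum>i\<in>V. \<Sum>j\<in>V. Y i j * ((g i - g j)\<^sup>2 / (2 * a) + a * ((g i)\<^sup>2 + (g j)\<^sup>2)))"
  proof (intro sum_mono mult_left_mono Y0)
    fix i j assume ij: "i \<in> V" "j \<in> V"
    \<comment> \<open>AM-GM with weight \<open>a\<close> replaces Cauchy-Schwarz; \<open>a = h / (4 C)\<close> balances the two terms.\<close>
    define p q where "p = g i - g j" and "q = g i + g j"
    have "0 \<le> (p - a * q)\<^sup>2 / (2 * a)" using a by simp
    also have "\<dots> = p\<^sup>2 / (2 * a) + a / 2 * q\<^sup>2 - p * q"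
      using a by (simp add: power2_eq_square field_simps)
    finally have "p * q \<le> p\<^sup>2 / (2 * a) + a / 2 * q\<^sup>2" by simp
    moreover have "q\<^sup>2 \<le> 2 * ((g i)\<^sup>2 + (g j)\<^sup>2)"
      using zero_le_power2[of "g i - g j"] by (simp add: q_def power2_eq_square algebra_simps)
    then have "a / 2 * q\<^sup>2 \<le> a / 2 * (2 * ((g i)\<^sup>2 + (g j)\<^sup>2))" using a by (intro mult_left_mono) auto
    then have "a / 2 * q\<^sup>2 \<le> a * ((g i)\<^sup>2 + (g j)\<^sup>2)" by (simp only: mult.assoc)
    moreover have "p * q = (g i)\<^sup>2 - (g j)\<^sup>2" by (simp add: p_def q_def power2_eq_square algebra_simps)
    moreover have "0 \<le> p\<^sup>2 / (2 * a) + a * ((g i)\<^sup>2 + (g j)\<^sup>2)" using a by simp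
    ultimately show "max 0 ((g i)\<^sup>2 - (g j)\<^sup>2) \<le> (g i - g j)\<^sup>2 / (2 * a) + a * ((g i)\<^sup>2 + (g j)\<^sup>2)"
      unfolding p_def[symmetric] by (intro max.boundedI) (assumption, linarith)
  qed auto
  also have "\<dots> = E / (2 * a) + a * ((\<Sum>i\<in>V. \<Sum>j\<in>V. (g i)\<^sup>2 * Y i j) + (\<Sum>i\<in>V. \<Sum>j\<in>V. (g j)\<^sup>2 * Y i j))"
    by (simp add: E_def sum.distrib sum_distrib_left sum_divide_distrib algebra_simps)
  also have "(\<Sum>i\<in>V. \<Sum>j\<in>V. (g i)\<^sup>2 * Y i j) = (\<Sum>i\<in>V. (g i)\<^sup>2 * (\<Sum>j\<in>V. Y i j))"
    by (simp add: sum_distrib_left)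
  also have "(\<Sum>i\<in>V. \<Sum>j\<in>V. (g j)\<^sup>2 * Y i j) = (\<Sum>j\<in>V. (g j)\<^sup>2 * (\<Sum>i\<in>V. Y i j))"
    by (subst sum.swap) (simp add: sum_distrib_left)
  also have "E / (2 * a) + a * ((\<Sum>i\<in>V. (g i)\<^sup>2 * (\<Sum>j\<in>V. Y i j)) + (\<Sum>j\<in>V. (g j)\<^sup>2 * (\<Sum>i\<in>V. Y i j)))
     \<le> E / (2 * a) + a * ((\<Sum>i\<in>V. (g i)\<^sup>2 * C) + (\<Sum>j\<in>V. (g j)\<^sup>2 * C))"
    using a row col by (intro add_left_mono mult_left_mono add_mono sum_mono) auto
  also have "\<dots> = E / (2 * a) + 2 * a * C * G"
    by (simp add: G_def sum_distrib_right[symmetric])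
  \<comment> \<open>Since \<open>2 * a * C = h / 2\<close>, half of \<open>h * G\<close> is
    absorbed, leaving \<open>h * G / 2 <= 2 * C * E / h\<close>.\<close>
  finally have "h * (h * G) \<le> h * (E / (2 * a) + 2 * a * C * G)" using h by simp
  then have "h\<^sup>2 * G \<le> 4 * C * E" using h C by (simp add: a_def power2_eq_square field_simps)
  then show ?thesis by (simp add: G_def E_def)
qed

text \<open>The witness is the least value of \<open>f\<close> with at most half of the points
  strictly above it.\<close>

lemma median_exists:
  fixes f :: "'v \<Rightarrow> real"
  assumes V: "finite V" "V \<noteq> {}"
  obtains t where "2 * card {i\<in>V. f i > t} \<le> card V" "2 * card {i\<in>V. f i < t} \<le> card V"
proof -
  define T where "T = {i\<in>V. 2 * card {j\<in>V. f j > f i} \<le> card V}"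
  have "Max (f ` V) \<in> f ` V" using V by (intro Max_in) auto
  then obtain k where k: "k \<in> V" "f k = Max (f ` V)" by auto
  then have "\<forall>j\<in>V. f j \<le> f k" using V by auto
  then have e: "{j\<in>V. f j > f k} = {}" by force
  have "k \<in> T" using k(1) unfolding T_def by (simp add: e)
  then have T: "finite T" "T \<noteq> {}" using V by (auto simp: T_def)
  define t where "t = Min (f ` T)"
  have "t \<in> f ` T" unfolding t_def using T by (intro Min_in) auto
  then obtain i0 where i0: "i0 \<in> T" "f i0 = t" by auto
  have le: "t \<le> f i" if "i \<in> T" for i unfolding t_def using that T by (intro Min_le) auto
  have "2 * card {i\<in>V. f i < t} \<le> card V"
  proof (cases "{i\<in>V. f i < t} = {}")
    case False
    define W where "W = {i\<in>V. f i < t}"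
    have W: "finite W" "W \<noteq> {}" using V False by (auto simp: W_def)
    have "Max (f ` W) \<in> f ` W" using W by (intro Max_in) auto
    then obtain l where l: "l \<in> W" "f l = Max (f ` W)" by auto
    \<comment> \<open>The points above the largest value below \<open>t\<close> are exactly those
      outside \<open>W\<close>. By minimality of \<open>t\<close> they are more than half, so
      \<open>W\<close> is less than half.\<close>
    have "f j \<le> f l" if "j \<in> W" for j using l that W by auto
    then have "{j\<in>V. f j > f l} = V - W" using l(1) by (force simp: W_def)
    moreover have "l \<notin> T" using le[of l] l(1) by (auto simp: W_def)
    ultimately have "\<not> 2 * card (V - W) \<le> card V" using l(1) by (auto simp: T_def W_def)
    moreover have "card (V - W) = card V - card W" "card W \<le> card V"
      using V by (auto simp: W_def card_Diff_subset card_mono)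
    ultimately show ?thesis unfolding W_def by linarith
  qed (simp only: card.empty mult_0_right)
  moreover have "2 * card {i\<in>V. f i > t} \<le> card V" using i0 by (auto simp: T_def)
  ultimately show ?thesis using that by blast
qed

text \<open>Subtracting a median splits \<open>f\<close> into a positive and a negative part, each
  supported on at most half of the vertices. Because \<open>f\<close> sums to zero, the shift can
  only increase the sum of squares.\<close>

theorem cheeger_poincare:
  fixes Y :: "'v \<Rightarrow> 'v \<Rightarrow> real" and f :: "'v \<Rightarrow> real"
  assumes V: "finite V" and h: "h > 0" and C: "C > 0"
    and Y0: "\<And>i j. i \<in> V \<Longrightarrow> j \<in> V \<Longrightarrow> 0 \<le> Y i j"
    and cut: "\<And>S. S \<subseteq> V \<Longrightarrow> S \<noteq> {} \<Longrightarrow> 2 * card S \<le> card V \<Longrightarrow>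
               h * real (card S) \<le> (\<Sum>i\<in>S. \<Sum>j\<in>V - S. Y i j)"
    and row: "\<And>i. i \<in> V \<Longrightarrow> (\<Sum>j\<in>V. Y i j) \<le> C"
    and col: "\<And>j. j \<in> V \<Longrightarrow> (\<Sum>i\<in>V. Y i j) \<le> C"
    and f: "(\<Sum>i\<in>V. f i) = 0"
  shows "h\<^sup>2 * (\<Sum>i\<in>V. (f i)\<^sup>2) \<le> 4 * C * (\<Sum>i\<in>V. \<Sum>j\<in>V. Y i j * (f i - f j)\<^sup>2)"
proof (cases "V = {}")
  case False
  obtain t where t: "2 * card {i\<in>V. f i > t} \<le> card V" "2 * card {i\<in>V. f i < t} \<le> card V"
    using median_exists[OF V False] by blast
  define p q where "p = (\<lambda>i. max 0 (f i - t))" and "q = (\<lambda>i. max 0 (t - f i))"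
  have "{i\<in>V. p i > 0} = {i\<in>V. f i > t}" "{i\<in>V. q i > 0} = {i\<in>V. f i < t}"
    by (auto simp: p_def q_def)
  then have P: "h\<^sup>2 * (\<Sum>i\<in>V. (p i)\<^sup>2) \<le> 4 * C * (\<Sum>i\<in>V. \<Sum>j\<in>V. Y i j * (p i - p j)\<^sup>2)"
    and Q: "h\<^sup>2 * (\<Sum>i\<in>V. (q i)\<^sup>2) \<le> 4 * C * (\<Sum>i\<in>V. \<Sum>j\<in>V. Y i j * (q i - q j)\<^sup>2)"
    using t by (intro poincare_half_support V h C Y0 cut row col; simp add: p_def q_def)+
  have "(\<Sum>i\<in>V. (f i)\<^sup>2) \<le> (\<Sum>i\<in>V. (f i)\<^sup>2) + real (card V) * t\<^sup>2" by simp
  also have "\<dots> = (\<Sum>i\<in>V. (f i - t)\<^sup>2)"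
    using f by (simp add: power2_diff sum.distrib sum_subtractf sum_distrib_left[symmetric] sum_distrib_right[symmetric])
  also have "\<dots> = (\<Sum>i\<in>V. (p i)\<^sup>2) + (\<Sum>i\<in>V. (q i)\<^sup>2)"
    unfolding sum.distrib[symmetric]
    by (intro sum.cong) (auto simp: p_def q_def max_def power2_eq_square algebra_simps)
  finally have "h\<^sup>2 * (\<Sum>i\<in>V. (f i)\<^sup>2) \<le> h\<^sup>2 * ((\<Sum>i\<in>V. (p i)\<^sup>2) + (\<Sum>i\<in>V. (q i)\<^sup>2))"
    by (intro mult_left_mono) auto
  also have "\<dots> \<le> 4 * C * (\<Sum>i\<in>V. \<Sum>j\<in>V. Y i j * (p i - p j)\<^sup>2 + Y i j * (q i - q j)\<^sup>2)"
    using P Q by (simp add: sum.distrib distrib_left)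
  also have "\<dots> \<le> 4 * C * (\<Sum>i\<in>V. \<Sum>j\<in>V. Y i j * (f i - f j)\<^sup>2)"
  proof (intro mult_left_mono sum_mono)
    fix i j assume ij: "i \<in> V" "j \<in> V"
    have *: "(p i - p j)\<^sup>2 + (q i - q j)\<^sup>2 \<le> (f i - f j)\<^sup>2"
    proof -
      \<comment> \<open>At each vertex one of \<open>p\<close>, \<open>q\<close> vanishes, so the
        only cross terms in the square of \<open>f i - f j\<close> are the mixed ones, and they have
        the favourable sign.\<close>
      have pf: "f k = t + p k - q k" "p k * q k = 0" "p k \<ge> 0" "q k \<ge> 0" for k
        by (auto simp: p_def q_def max_def)
      have "(f i - f j)\<^sup>2 = (p i - p j)\<^sup>2 + (q i - q j)\<^sup>2 + 2 * (p i * q j + p j * q i) - 2 * (p i * q i) - 2 * (p j * q j)"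
        unfolding pf(1)[of i] pf(1)[of j] by (simp add: power2_eq_square algebra_simps)
      then show ?thesis using pf(2)[of i] pf(2)[of j] pf(3,4)
        by (smt (verit) mult_nonneg_nonneg)
    qed
    show "Y i j * (p i - p j)\<^sup>2 + Y i j * (q i - q j)\<^sup>2 \<le> Y i j * (f i - f j)\<^sup>2"
      using mult_left_mono[OF * Y0[OF ij]] by (simp add: distrib_left)
  qed (use C in auto)
  finally show ?thesis .
qed simp

section \<open>Invariant measures of generators with a spectral gap\<close>

text \<open>The right-hand side of \<open>gap\<close> is minus the quadratic form of the generator at \<open>f\<close>, written as
  a Dirichlet form plus a correction for the missing symmetry (\<open>flow_quadratic\<close>).\<close>

locale nonneg_rates =
  fixes n :: nat and X :: "nat \<Rightarrow> nat \<Rightarrow> real" and c :: real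
  assumes n: "n \<ge> 2" and c: "c > 0"
    and X0: "\<And>i j. i < n \<Longrightarrow> j < n \<Longrightarrow> 0 \<le> X i j"
    and edge: "\<And>S. S \<subseteq> {..<n} \<Longrightarrow> S \<noteq> {} \<Longrightarrow> S \<noteq> {..<n} \<Longrightarrow> \<exists>i\<in>S. \<exists>j\<in>{..<n} - S. 0 < X i j"
    and gap: "\<And>f :: nat \<Rightarrow> real. (\<Sum>i<n. f i) = 0 \<Longrightarrow>
       c * (\<Sum>i<n. (f i)\<^sup>2) \<le> (\<Sum>i<n. \<Sum>j<n. X i j * (f i - f j)\<^sup>2) / 2
          - (\<Sum>j<n. (f j)\<^sup>2 * ((\<Sum>i<n. X i j) - (\<Sum>i<n. X j i))) / 2"
begin

abbreviation row :: "nat \<Rightarrow> real" where "row i \<equiv> \<Sum>j<n. X i j"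
abbreviation col :: "nat \<Rightarrow> real" where "col j \<equiv> \<Sum>i<n. X i j"

definition G :: "real mat" where "G = markov_generator (mat n n (\<lambda>(i, j). X i j))"

text \<open>Entry \<open>j\<close> of the row vector \<open>f\<close> times \<open>G\<close>: the
  net rate at which mass distributed as \<open>f\<close> enters state \<open>j\<close>.\<close>

definition flow :: "(nat \<Rightarrow> real) \<Rightarrow> nat \<Rightarrow> real" where
  "flow f j = (\<Sum>i<n. f i * X i j) - f j * row j"

lemma G_carrier [simp]: "G \<in> carrier_mat n n" "dim_row G = n" "dim_col G = n"
  by (auto simp: G_def markov_generator_def row_sum_diag_def)

lemma G_index: "i < n \<Longrightarrow> j < n \<Longrightarrow> G $$ (i, j) = X i j - (if i = j then row i else 0)"
  by (simp add: G_def markov_generator_def row_sum_diag_def)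

lemma transpose_G_mult:
  assumes "P \<in> carrier_vec n" "j < n"
  shows "(transpose_mat G *\<^sub>v P) $ j = flow (\<lambda>i. P $ i) j"
proof -
  have "(transpose_mat G *\<^sub>v P) $ j = (\<Sum>i<n. G $$ (i, j) * P $ i)"
    using assms by (auto simp: scalar_prod_def atLeast0LessThan intro!: sum.cong)
  also have "\<dots> = (\<Sum>i<n. P $ i * X i j - (if i = j then P $ j * row j else 0))"
    using assms by (intro sum.cong) (auto simp: G_index algebra_simps)
  also have "\<dots> = flow (\<lambda>i. P $ i) j"
    using assms by (simp add: flow_def sum_subtractf)
  finally show ?thesis .
qed

lemma transpose_G_kernel_iff:
  assumes "P \<in> carrier_vec n"
  shows "transpose_mat G *\<^sub>v P = 0\<^sub>v n \<longleftrightarrow> (\<forall>j<n. flow (\<lambda>i. P $ i) j = 0)"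
  using transpose_G_mult[OF assms] by (auto simp: vec_eq_iff)

text \<open>Expanding the Dirichlet form produces row and column sums symmetrically, while the
  generator subtracts row sums only. Half of the difference remains as the correction.\<close>

lemma flow_quadratic:
  "(\<Sum>j<n. f j * flow f j) = (\<Sum>j<n. (f j)\<^sup>2 * (col j - row j)) / 2 - (\<Sum>i<n. \<Sum>j<n. X i j * (f i - f j)\<^sup>2) / 2"
proof -
  define T where "T = (\<Sum>i<n. \<Sum>j<n. X i j * (f i * f j))"
  have "(\<Sum>i<n. \<Sum>j<n. X i j * (f i - f j)\<^sup>2) =
      (\<Sum>i<n. \<Sum>j<n. (f i)\<^sup>2 * X i j) + (\<Sum>i<n. \<Sum>j<n. (f j)\<^sup>2 * X i j) - 2 * T"
    unfolding T_def sum_distrib_left sum.distrib[symmetric] sum_subtractf[symmetric]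
    by (intro sum.cong refl) (simp add: power2_eq_square algebra_simps)
  also have "(\<Sum>i<n. \<Sum>j<n. (f j)\<^sup>2 * X i j) = (\<Sum>j<n. (f j)\<^sup>2 * col j)"
    by (subst sum.swap) (simp add: sum_distrib_left)
  also have "(\<Sum>i<n. \<Sum>j<n. (f i)\<^sup>2 * X i j) = (\<Sum>j<n. (f j)\<^sup>2 * row j)"
    by (simp add: sum_distrib_left)
  finally have E: "(\<Sum>i<n. \<Sum>j<n. X i j * (f i - f j)\<^sup>2) =
      (\<Sum>j<n. (f j)\<^sup>2 * row j) + (\<Sum>j<n. (f j)\<^sup>2 * col j) - 2 * T" .
  have "(\<Sum>j<n. f j * flow f j) = (\<Sum>j<n. \<Sum>i<n. X i j * (f i * f j)) - (\<Sum>j<n. (f j)\<^sup>2 * row j)"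
    unfolding flow_def sum_subtractf[symmetric]
    by (intro sum.cong refl) (simp add: sum_distrib_left right_diff_distrib power2_eq_square ac_simps)
  also have "(\<Sum>j<n. \<Sum>i<n. X i j * (f i * f j)) = T" unfolding T_def by (rule sum.swap)
  finally show ?thesis unfolding E by (simp add: right_diff_distrib sum_subtractf field_simps)
qed

lemma gap_flow: "(\<Sum>i<n. f i) = 0 \<Longrightarrow> c * (\<Sum>i<n. (f i)\<^sup>2) \<le> - (\<Sum>j<n. f j * flow f j)"
  using gap[of f] unfolding flow_quadratic by simp

text \<open>The gap makes the generator injective on vectors of zero sum. This gives uniqueness, and
  it also shows that a nonzero kernel vector has nonzero sum and can be normalised.\<close>

lemma flow_kernel_zero:
  assumes "(\<Sum>i<n. f i) = 0" "\<And>j. j < n \<Longrightarrow> flow f j = 0" "i < n"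
  shows "f i = 0"
proof -
  have "c * (\<Sum>i<n. (f i)\<^sup>2) \<le> 0" using gap_flow[OF assms(1)] assms(2) by simp
  then have "(\<Sum>i<n. (f i)\<^sup>2) \<le> 0" using c by (simp add: mult_le_0_iff)
  then have "(\<Sum>i<n. (f i)\<^sup>2) = 0" using sum_nonneg[of "{..<n}" "\<lambda>i. (f i)\<^sup>2"] by simp
  then show ?thesis using assms(3) by (simp add: sum_nonneg_eq_0_iff)
qed

lemma flow_diff: "flow (\<lambda>i. f i - g i) j = flow f j - flow g j"
  by (simp add: flow_def left_diff_distrib sum_subtractf)

lemma flow_divide: "flow (\<lambda>i. f i / a) j = flow f j / a"
  by (simp add: flow_def diff_divide_distrib sum_divide_distrib)

section \<open>Irreducibility, and existence, uniqueness and positivity of the invariant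
  measure\<close>

lemma irreducible: "irreducible_generator G"
  unfolding irreducible_generator_def G_carrier
proof (intro allI impI)
  fix i j assume ij: "i < n" "j < n"
  define S where "S = {k. k < n \<and> (i, k) \<in> (jump_rel G)\<^sup>*}"
  have "S = {..<n}"
  proof (rule ccontr)
    assume "S \<noteq> {..<n}"
    moreover have "S \<subseteq> {..<n}" "i \<in> S" using ij by (auto simp: S_def)
    ultimately obtain k l where kl: "k \<in> S" "l \<in> {..<n} - S" "0 < X k l" using edge[of S] by blast
    then have "(k, l) \<in> jump_rel G" by (auto simp: jump_rel_def G_index S_def)
    then have "l \<in> S" using kl by (auto simp: S_def intro: rtrancl_into_rtrancl)
    then show False using kl by simp
  qed
  then show "(i, j) \<in> (jump_rel G)\<^sup>*" using ij by (auto simp: S_def)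
qed

text \<open>This does the work of the Perron-Frobenius theorem. The triangle inequality makes every
  entry of the flow of the absolute values nonnegative, and total mass is conserved, so the entries
  sum to zero and all vanish.\<close>

lemma flow_kernel_abs:
  assumes f: "\<And>j. j < n \<Longrightarrow> flow f j = 0" and j: "j < n"
  shows "flow (\<lambda>i. \<bar>f i\<bar>) j = 0"
proof -
  have row0: "row j \<ge> 0" if "j < n" for j using that X0 by (auto intro: sum_nonneg)
  have nonneg: "flow (\<lambda>i. \<bar>f i\<bar>) j \<ge> 0" if "j < n" for j
  proof -
    have "\<bar>f j\<bar> * row j = \<bar>f j * row j\<bar>" using row0[OF that] by (simp add: abs_mult)
    also have "\<dots> = \<bar>\<Sum>i<n. f i * X i j\<bar>" using f[OF that] by (simp add: flow_def)
    also have "\<dots> \<le> (\<Sum>i<n. \<bar>f i * X i j\<bar>)" by (rule sum_abs)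
    also have "\<dots> = (\<Sum>i<n. \<bar>f i\<bar> * X i j)"
      using X0 that by (intro sum.cong) (auto simp: abs_mult)
    finally show ?thesis by (simp add: flow_def)
  qed
  have "(\<Sum>j<n. flow (\<lambda>i. \<bar>f i\<bar>) j) = (\<Sum>j<n. \<Sum>i<n. \<bar>f i\<bar> * X i j) - (\<Sum>i<n. \<bar>f i\<bar> * row i)"
    by (simp add: flow_def sum_subtractf)
  also have "(\<Sum>j<n. \<Sum>i<n. \<bar>f i\<bar> * X i j) = (\<Sum>i<n. \<bar>f i\<bar> * row i)"
    by (subst sum.swap) (simp add: sum_distrib_left)
  finally show ?thesis
    using nonneg j sum_nonneg_eq_0_iff[of "{..<n}" "flow (\<lambda>i. \<bar>f i\<bar>)"] by auto
qed

text \<open>A vertex where \<open>f\<close> vanishes has no outflow, hence no inflow. So no edge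
  leaves the support of \<open>f\<close>, and \<open>edge\<close> makes the support
  everything.\<close>

lemma flow_kernel_pos:
  assumes f: "\<And>j. j < n \<Longrightarrow> flow f j = 0" and f0: "\<And>i. i < n \<Longrightarrow> 0 \<le> f i"
    and ne: "(\<Sum>i<n. f i) \<noteq> 0" and i: "i < n"
  shows "f i > 0"
proof -
  define S where "S = {i. i < n \<and> f i > 0}"
  have "S \<noteq> {}"
  proof
    assume "S = {}"
    then have "\<And>i. i < n \<Longrightarrow> f i = 0" using f0 unfolding S_def by force
    then show False using ne by simp
  qed
  moreover have "S \<subseteq> {..<n}" by (auto simp: S_def)
  moreover have "X k j = 0" if "k \<in> S" "j \<in> {..<n} - S" for k j
  proof -
    have "f j = 0" "j < n" using that(2) f0[of j] by (auto simp: S_def)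
    then have "(\<Sum>i<n. f i * X i j) = 0" using f[of j] by (simp add: flow_def)
    moreover have "\<And>i. i \<in> {..<n} \<Longrightarrow> 0 \<le> f i * X i j" using f0 X0 \<open>j < n\<close> by auto
    ultimately have Z: "\<forall>i\<in>{..<n}. f i * X i j = 0"
      using sum_nonneg_eq_0_iff[of "{..<n}" "\<lambda>i. f i * X i j"] by simp
    have "f k * X k j = 0" by (rule bspec[OF Z]) (use that(1) in \<open>simp add: S_def\<close>)
    then show ?thesis using that(1) by (auto simp: S_def)
  qed
  ultimately have "S = {..<n}" using edge[of S] by force
  then show ?thesis using i by (auto simp: S_def)
qed

text \<open>\<open>G\<close> annihilates the constant vector, so its determinant and that of its
  transpose are zero. The kernel vector thus obtained is divided by its sum.\<close>

lemma ex_flow_kernel: "\<exists>f. (\<forall>j<n. flow f j = 0) \<and> (\<Sum>i<n. f i) = 1"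
proof -
  have "G *\<^sub>v vec n (\<lambda>_. 1) = 0\<^sub>v n"
  proof (rule eq_vecI)
    fix i assume "i < dim_vec (0\<^sub>v n :: real vec)"
    then have i: "i < n" by simp
    have "(G *\<^sub>v vec n (\<lambda>_. 1)) $ i = (\<Sum>j<n. G $$ (i, j))"
      using i by (auto simp: scalar_prod_def atLeast0LessThan intro!: sum.cong)
    also have "\<dots> = (\<Sum>j<n. X i j - (if i = j then row i else 0))"
      using i by (intro sum.cong) (auto simp: G_index)
    also have "\<dots> = 0" using i by (simp add: sum_subtractf)
    finally show "(G *\<^sub>v vec n (\<lambda>_. 1)) $ i = 0\<^sub>v n $ i" using i by simp
  qed (simp add: G_carrier)
  moreover have "vec n (\<lambda>_. 1 :: real) \<noteq> 0\<^sub>v n"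
  proof
    assume "vec n (\<lambda>_. 1 :: real) = 0\<^sub>v n"
    then have "vec n (\<lambda>_. 1 :: real) $ 0 = 0\<^sub>v n $ 0" by simp
    then show False using n by simp
  qed
  ultimately have "det G = 0" using det_0_iff_vec_prod_zero[OF G_carrier(1)] vec_carrier by blast
  then have "det (transpose_mat G) = 0" by (simp add: det_transpose[OF G_carrier(1)])
  then obtain v where v: "v \<in> carrier_vec n" "v \<noteq> 0\<^sub>v n" "transpose_mat G *\<^sub>v v = 0\<^sub>v n"
    using det_0_iff_vec_prod_zero[of "transpose_mat G" n] by auto
  define f where "f = (\<lambda>i. v $ i)"
  have k: "\<And>j. j < n \<Longrightarrow> flow f j = 0"
    using transpose_G_kernel_iff[OF v(1)] v(3) by (auto simp: f_def)
  have "(\<Sum>i<n. f i) \<noteq> 0"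
  proof
    assume "(\<Sum>i<n. f i) = 0"
    then have "\<And>i. i < n \<Longrightarrow> f i = 0" using flow_kernel_zero k by blast
    then have "v = 0\<^sub>v n" using v(1) by (intro eq_vecI) (auto simp: f_def)
    then show False using v(2) by simp
  qed
  then show ?thesis using k
    by (intro exI[of _ "\<lambda>i. f i / (\<Sum>i<n. f i)"]) (simp add: flow_divide sum_divide_distrib[symmetric])
qed

lemma flow_kernel_unique:
  assumes "\<forall>j<n. flow f j = 0" "(\<Sum>i<n. f i) = 1" "\<forall>j<n. flow g j = 0" "(\<Sum>i<n. g i) = 1" "i < n"
  shows "f i = g i"
  using flow_kernel_zero[of "\<lambda>i. f i - g i" i] assms by (simp add: flow_diff sum_subtractf)

lemma ex1_invariant: "\<exists>!P. is_invariant_measure G P"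
proof -
  obtain f where f: "\<forall>j<n. flow f j = 0" "(\<Sum>i<n. f i) = 1" using ex_flow_kernel by blast
  define s where "s = (\<Sum>i<n. \<bar>f i\<bar>)"
  have "1 \<le> s" using f(2) sum_abs[of f "{..<n}"] by (simp add: s_def)
  define g where "g = (\<lambda>i. \<bar>f i\<bar> / s)"
  have g: "\<forall>j<n. flow g j = 0" "(\<Sum>i<n. g i) = 1"
    unfolding g_def flow_divide using flow_kernel_abs[of f] f \<open>1 \<le> s\<close>
    by (simp_all add: sum_divide_distrib[symmetric] s_def[symmetric])
  have pos: "g i > 0" if "i < n" for i
    by (rule flow_kernel_pos) (use g that \<open>1 \<le> s\<close> in \<open>auto simp: g_def\<close>)
  \<comment> \<open>A second state exists because \<open>n >= 2\<close>, and it carries positive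
    mass.\<close>
  have lt1: "g i < 1" if "i < n" for i
  proof -
    obtain k where k: "k < n" "k \<noteq> i"
      using n by (metis less_le_trans not_less_eq_eq numeral_2_eq_2 pos2 zero_neq_one lessI)
    have "g i + g k = sum g {i, k}" using k by simp
    also have "\<dots> \<le> sum g {..<n}" using k that pos by (intro sum_mono2) (auto intro: less_imp_le)
    finally show ?thesis using g(2) pos[OF k(1)] by simp
  qed
  have inv: "is_invariant_measure G (vec n g)"
  proof -
    have "flow (\<lambda>i. vec n g $ i) j = flow g j" if "j < n" for j
      using that by (simp add: flow_def)
    then show ?thesis
      using transpose_G_kernel_iff[of "vec n g"] g pos lt1 by (simp add: is_invariant_measure_def)
  qed
  have uniq: "P = vec n g" if P: "is_invariant_measure G P" for P
  proof -
    from P have Pc: "P \<in> carrier_vec n" by (simp add: is_invariant_measure_def)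
    have "P $ i = g i" if "i < n" for i
    proof (rule flow_kernel_unique[OF _ _ g that])
      have "transpose_mat G *\<^sub>v P = 0\<^sub>v n" "(\<Sum>i<n. P $ i) = 1"
        using P by (simp_all add: is_invariant_measure_def)
      then show "\<forall>j<n. flow (\<lambda>i. P $ i) j = 0" "(\<Sum>i<n. P $ i) = 1"
        unfolding transpose_G_kernel_iff[OF Pc] .
    qed
    then show ?thesis using Pc by (intro eq_vecI) auto
  qed
  show ?thesis by (rule ex1I[where P = "is_invariant_measure G" and a = "vec n g"]) (fact inv, fact uniq)
qed

lemma tv_invariant_uniform:
  "tv_norm (invariant_measure G - uniform_vec n) \<le> sqrt ((\<Sum>j<n. (col j - row j)\<^sup>2) / real n) / (2 * c)"
proof -
  define P where "P = invariant_measure G"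
  have "is_invariant_measure G P"
    unfolding P_def invariant_measure_def by (rule theI'[OF ex1_invariant])
  then have P: "P \<in> carrier_vec n" "(\<Sum>i<n. P $ i) = 1" "\<forall>j<n. flow (\<lambda>i. P $ i) j = 0"
    using transpose_G_kernel_iff by (auto simp: is_invariant_measure_def)
  define \<delta> where "\<delta> = (\<lambda>i. P $ i - 1 / real n)"
  define A B where "A = (\<Sum>i<n. (\<delta> i)\<^sup>2)" and "B = (\<Sum>j<n. (col j - row j)\<^sup>2)"
  have n0: "real n > 0" using n by simp
  have A0: "A \<ge> 0" "B \<ge> 0" by (auto simp: A_def B_def intro: sum_nonneg)
  have flow\<delta>: "flow \<delta> j = - (col j - row j) / real n" if "j < n" for j
    unfolding \<delta>_def flow_diff using P(3) that
    by (simp add: flow_def sum_divide_distrib[symmetric] diff_divide_distrib)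
  have "(\<Sum>i<n. \<delta> i) = 0" using P(2) n0 by (simp add: \<delta>_def sum_subtractf)
  from gap_flow[OF this] have "c * A \<le> - (\<Sum>j<n. \<delta> j * (- (col j - row j) / real n))"
    by (simp add: A_def flow\<delta>)
  also have "\<dots> = (\<Sum>j<n. \<delta> j * (col j - row j)) / real n"
    by (simp add: sum_negf[symmetric] sum_divide_distrib del: minus_diff_eq)
  finally have "(c * A)\<^sup>2 \<le> ((\<Sum>j<n. \<delta> j * (col j - row j)) / real n)\<^sup>2"
    using c A0 by (intro power_mono) auto
  also have "\<dots> \<le> A * B / (real n)\<^sup>2"
    using Cauchy_Schwarz_ineq_sum[of \<delta> "\<lambda>j. col j - row j" "{..<n}"] n0
    by (simp add: A_def B_def power_divide divide_right_mono)
  \<comment> \<open>Squaring before Cauchy-Schwarz puts a factor \<open>A\<close> on the right as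
    well. It is cancelled, with \<open>A = 0\<close> treated apart.\<close>
  finally have "c\<^sup>2 * A * A \<le> (B / (real n)\<^sup>2) * A" by (simp add: power2_eq_square ac_simps)
  then have A: "c\<^sup>2 * A \<le> B / (real n)\<^sup>2" using A0 mult_right_le_imp_le[of "c\<^sup>2 * A" A "B / (real n)\<^sup>2"] by (cases "A = 0") auto
  have "(\<Sum>i<n. \<bar>\<delta> i\<bar>)\<^sup>2 \<le> real n * A"
    using Cauchy_Schwarz_ineq_sum[of "\<lambda>_. 1" "\<lambda>i. \<bar>\<delta> i\<bar>" "{..<n}"] by (simp add: A_def)
  then have "(c * (\<Sum>i<n. \<bar>\<delta> i\<bar>))\<^sup>2 \<le> c\<^sup>2 * (real n * A)"
    by (simp add: power_mult_distrib mult_left_mono)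
  also have "\<dots> \<le> real n * (B / (real n)\<^sup>2)" 
    unfolding mult.left_commute[of "c\<^sup>2"] using A by (intro mult_left_mono) auto
  also have "\<dots> = B / real n" using n0 by (simp add: power2_eq_square)
  finally have "c * (\<Sum>i<n. \<bar>\<delta> i\<bar>) \<le> sqrt (B / real n)" by (rule real_le_rsqrt)
  then have "(\<Sum>i<n. \<bar>\<delta> i\<bar>) \<le> sqrt (B / real n) / c" using c by (simp add: field_simps)
  moreover have "tv_norm (P - uniform_vec n) = (\<Sum>i<n. \<bar>\<delta> i\<bar>) / 2"
    using P(1) by (simp add: tv_norm_def uniform_vec_def \<delta>_def)
  ultimately show ?thesis by (simp add: P_def B_def)
qed

end

section \<open>Tails of sums of independent variables\<close>

text \<open>Valid for every nonnegative \<open>u\<close>, so lower tails can be bounded by second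
  moments alone, without truncation.\<close>

lemma exp_minus_le: "exp (- u) \<le> 1 - u + u\<^sup>2 / 2" if "u \<ge> 0" for u :: real
proof -
  define f where "f = (\<lambda>u::real. 1 - u + u\<^sup>2 / 2 - exp (- u))"
  have "f 0 \<le> f u"
  proof (rule DERIV_nonneg_imp_nondecreasing[OF that])
    fix y :: real
    have "(f has_real_derivative (- 1 + y + exp (- y))) (at y)"
      unfolding f_def by (auto intro!: derivative_eq_intros)
    moreover have "- 1 + y + exp (- y) \<ge> 0" using exp_ge_add_one_self[of "- y"] by simp
    ultimately show "\<exists>d. (f has_real_derivative d) (at y) \<and> 0 \<le> d" by blast
  qed
  then show ?thesis by (simp add: f_def)
qed

context prob_space
begin

section \<open>Moments of sums of independent centred variables\<close>

lemma integrable_power_of_fourth: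
  fixes Z :: "'a \<Rightarrow> real"
  assumes [measurable]: "random_variable borel Z" and Z: "integrable M (\<lambda>\<omega>. Z \<omega> ^ 4)" and k: "k \<le> 4"
  shows "integrable M (\<lambda>\<omega>. Z \<omega> ^ k)"
proof (rule Bochner_Integration.integrable_bound[of _ "\<lambda>\<omega>. 1 + Z \<omega> ^ 4"])
  have "\<bar>z\<bar> ^ k \<le> 1 + z ^ 4" for z :: real
  proof (cases "\<bar>z\<bar> \<le> 1")
    case True then show ?thesis by (smt (verit) abs_ge_zero power_le_one zero_le_even_power even_numeral)
  next
    case False
    then have "\<bar>z\<bar> ^ k \<le> \<bar>z\<bar> ^ 4" using k by (intro power_increasing) auto
    then show ?thesis by (simp add: power_even_abs)
  qed
  then show "AE \<omega> in M. norm (Z \<omega> ^ k) \<le> norm (1 + Z \<omega> ^ 4)"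
    by (auto simp: power_abs)
qed (use Z in auto)

lemma indep_var_powers:
  fixes A B :: "'a \<Rightarrow> real"
  assumes ind: "indep_var borel A borel B"
    and A: "integrable M (\<lambda>\<omega>. A \<omega> ^ j)" and B: "integrable M (\<lambda>\<omega>. B \<omega> ^ k)"
  shows "integrable M (\<lambda>\<omega>. A \<omega> ^ j * B \<omega> ^ k)"
    and "expectation (\<lambda>\<omega>. A \<omega> ^ j * B \<omega> ^ k) = expectation (\<lambda>\<omega>. A \<omega> ^ j) * expectation (\<lambda>\<omega>. B \<omega> ^ k)"
proof -
  have i: "indep_var borel (\<lambda>\<omega>. A \<omega> ^ j) borel (\<lambda>\<omega>. B \<omega> ^ k)"
    using indep_var_compose[OF ind, of "\<lambda>x. x ^ j" borel "\<lambda>x. x ^ k" borel] by (simp add: comp_def)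
  show "integrable M (\<lambda>\<omega>. A \<omega> ^ j * B \<omega> ^ k)"
    by (rule indep_var_integrable[OF i A B])
  show "expectation (\<lambda>\<omega>. A \<omega> ^ j * B \<omega> ^ k) = expectation (\<lambda>\<omega>. A \<omega> ^ j) * expectation (\<lambda>\<omega>. B \<omega> ^ k)"
    by (rule indep_var_lebesgue_integral[OF i A B])
qed

lemma indep_sum_second_moment:
  fixes Z :: "'i \<Rightarrow> 'a \<Rightarrow> real"
  assumes "finite I" and "indep_vars (\<lambda>_. borel) Z I"
    and "\<And>i. i \<in> I \<Longrightarrow> integrable M (Z i)"
    and "\<And>i. i \<in> I \<Longrightarrow> integrable M (\<lambda>\<omega>. (Z i \<omega>)\<^sup>2)"
    and "\<And>i. i \<in> I \<Longrightarrow> expectation (Z i) = 0"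
  shows "integrable M (\<lambda>\<omega>. (\<Sum>i\<in>I. Z i \<omega>)\<^sup>2)"
    and "expectation (\<lambda>\<omega>. (\<Sum>i\<in>I. Z i \<omega>)\<^sup>2) = (\<Sum>i\<in>I. expectation (\<lambda>\<omega>. (Z i \<omega>)\<^sup>2))"
proof -
  have "integrable M (\<lambda>\<omega>. (\<Sum>i\<in>I. Z i \<omega>)\<^sup>2) \<and>
    expectation (\<lambda>\<omega>. (\<Sum>i\<in>I. Z i \<omega>)\<^sup>2) = (\<Sum>i\<in>I. expectation (\<lambda>\<omega>. (Z i \<omega>)\<^sup>2))"
    using assms
  proof (induction I rule: finite_induct)
    case (insert i I)
    let ?S = "\<lambda>\<omega>. \<Sum>i\<in>I. Z i \<omega>"
    have IH: "integrable M (\<lambda>\<omega>. (?S \<omega>)\<^sup>2)"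
      "expectation (\<lambda>\<omega>. (?S \<omega>)\<^sup>2) = (\<Sum>i\<in>I. expectation (\<lambda>\<omega>. (Z i \<omega>)\<^sup>2))"
      using insert.IH[OF indep_vars_subset[OF insert.prems(1)]] insert.prems by auto
    have S1: "integrable M ?S" using insert.prems by auto
    have ind: "indep_var borel (Z i) borel ?S"
      using insert.hyps insert.prems(1) by (rule indep_vars_sum)
    note P = indep_var_powers[OF ind, of 1 1, simplified, OF insert.prems(2)[OF insertI1] S1]
    have e: "(\<Sum>k\<in>insert i I. Z k \<omega>)\<^sup>2 = (Z i \<omega>)\<^sup>2 + 2 * (Z i \<omega> * ?S \<omega>) + (?S \<omega>)\<^sup>2" for \<omega>
      using insert.hyps by (simp add: power2_sum)
    have "expectation (Z i) = 0" by (rule insert.prems(4)) simp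
    moreover have "integrable M (\<lambda>\<omega>. (Z i \<omega>)\<^sup>2)" by (rule insert.prems(3)) simp
    ultimately show ?case unfolding e using P IH insert.hyps by simp
  qed (simp add: prob_space)
  then show "integrable M (\<lambda>\<omega>. (\<Sum>i\<in>I. Z i \<omega>)\<^sup>2)"
    and "expectation (\<lambda>\<omega>. (\<Sum>i\<in>I. Z i \<omega>)\<^sup>2) = (\<Sum>i\<in>I. expectation (\<lambda>\<omega>. (Z i \<omega>)\<^sup>2))"
    by (rule conjunct1, rule conjunct2)
qed

text \<open>One variable is added at a time. Terms with an odd power vanish by centring, and the
  mixed square term \<open>6 * k * v^2\<close>, with \<open>k\<close> the current number of
  variables, is at most the increment \<open>3 * (k + 1)^2 * v^2 - 3 * k^2 * v^2\<close>.\<close>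

lemma indep_sum_fourth_moment:
  fixes Z :: "'i \<Rightarrow> 'a \<Rightarrow> real"
  assumes "finite I" and "indep_vars (\<lambda>_. borel) Z I"
    and "\<And>i. i \<in> I \<Longrightarrow> integrable M (\<lambda>\<omega>. Z i \<omega> ^ 4)"
    and "\<And>i. i \<in> I \<Longrightarrow> expectation (Z i) = 0"
    and "\<And>i. i \<in> I \<Longrightarrow> expectation (\<lambda>\<omega>. (Z i \<omega>)\<^sup>2) = v"
    and "\<And>i. i \<in> I \<Longrightarrow> expectation (\<lambda>\<omega>. Z i \<omega> ^ 4) \<le> w"
  shows "integrable M (\<lambda>\<omega>. (\<Sum>i\<in>I. Z i \<omega>) ^ 4)"
    and "expectation (\<lambda>\<omega>. (\<Sum>i\<in>I. Z i \<omega>) ^ 4) \<le> real (card I) * w + 3 * (real (card I))\<^sup>2 * v\<^sup>2"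
proof -
  have "integrable M (\<lambda>\<omega>. (\<Sum>i\<in>I. Z i \<omega>) ^ 4) \<and>
    expectation (\<lambda>\<omega>. (\<Sum>i\<in>I. Z i \<omega>) ^ 4) \<le> real (card I) * w + 3 * (real (card I))\<^sup>2 * v\<^sup>2"
    using assms
  proof (induction I rule: finite_induct)
    case (insert i I)
    let ?S = "\<lambda>\<omega>. \<Sum>i\<in>I. Z i \<omega>"
    have rv: "random_variable borel (Z k)" if "k \<in> insert i I" for k
      using insert.prems(1) that by (auto simp: indep_vars_def)
    have indI: "indep_vars (\<lambda>_. borel) Z I" by (rule indep_vars_subset[OF insert.prems(1)]) auto
    have IH: "integrable M (\<lambda>\<omega>. ?S \<omega> ^ 4)"
      "expectation (\<lambda>\<omega>. ?S \<omega> ^ 4) \<le> real (card I) * w + 3 * (real (card I))\<^sup>2 * v\<^sup>2"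
      using insert.IH[OF indI] insert.prems by auto
    have rS: "random_variable borel ?S" by (rule borel_measurable_sum) (simp add: rv)
    have ZI: "integrable M (\<lambda>\<omega>. Z k \<omega> ^ p)" if "k \<in> insert i I" "p \<le> 4" for k p
      by (rule integrable_power_of_fourth[OF rv[OF that(1)] insert.prems(2)[OF that(1)] that(2)])
    have SI: "integrable M (\<lambda>\<omega>. ?S \<omega> ^ p)" if "p \<le> 4" for p
      by (rule integrable_power_of_fourth[OF rS IH(1) that])
    have Z1: "integrable M (Z k)" if "k \<in> insert i I" for k using ZI[OF that, of 1] by simp
    have ind: "indep_var borel (Z i) borel ?S"
      using insert.hyps insert.prems(1) by (rule indep_vars_sum)
    have S2: "expectation (\<lambda>\<omega>. (?S \<omega>)\<^sup>2) = real (card I) * v"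
      using indep_sum_second_moment(2)[OF insert.hyps(1) indI] Z1 ZI[of _ 2] insert.prems(3,4) by simp
    have E1: "expectation ?S = 0" using Z1 insert.prems(3) by simp
    have P: "integrable M (\<lambda>\<omega>. Z i \<omega> ^ p * ?S \<omega> ^ r)"
      "expectation (\<lambda>\<omega>. Z i \<omega> ^ p * ?S \<omega> ^ r) = expectation (\<lambda>\<omega>. Z i \<omega> ^ p) * expectation (\<lambda>\<omega>. ?S \<omega> ^ r)"
      if "p \<le> 4" "r \<le> 4" for p r
      using indep_var_powers[OF ind ZI SI] that by auto
    have e: "(\<Sum>k\<in>insert i I. Z k \<omega>) ^ 4 = Z i \<omega> ^ 4 + 4 * (Z i \<omega> ^ 3 * ?S \<omega> ^ 1) + 6 * (Z i \<omega> ^ 2 * ?S \<omega> ^ 2)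
        + 4 * (Z i \<omega> ^ 1 * ?S \<omega> ^ 3) + ?S \<omega> ^ 4" for \<omega>
      using insert.hyps by (simp add: eval_nat_numeral algebra_simps)
    have int: "integrable M (\<lambda>\<omega>. (\<Sum>k\<in>insert i I. Z k \<omega>) ^ 4)"
      unfolding e using P(1)[of 3 1] P(1)[of 2 2] P(1)[of 1 3] ZI[of i 4] IH(1) by simp
    have "expectation (\<lambda>\<omega>. (\<Sum>k\<in>insert i I. Z k \<omega>) ^ 4) =
        expectation (\<lambda>\<omega>. Z i \<omega> ^ 4) + 6 * (v * (real (card I) * v)) + expectation (\<lambda>\<omega>. ?S \<omega> ^ 4)"
      unfolding e using P(1)[of 3 1] P(1)[of 2 2] P(1)[of 1 3] P(2)[of 3 1] P(2)[of 2 2] P(2)[of 1 3]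
        ZI[of i 4] IH(1) S2 E1 insert.prems(3)[of i] insert.prems(4)[of i] by simp
    also have "\<dots> \<le> w + 6 * (v * (real (card I) * v)) + (real (card I) * w + 3 * (real (card I))\<^sup>2 * v\<^sup>2)"
      using IH(2) insert.prems(5)[of i] by simp
    also have "\<dots> \<le> real (card (insert i I)) * w + 3 * (real (card (insert i I)))\<^sup>2 * v\<^sup>2"
      using insert.hyps by (simp add: power2_eq_square algebra_simps)
    finally show ?case using int by blast
  qed (simp add: prob_space)
  then show "integrable M (\<lambda>\<omega>. (\<Sum>i\<in>I. Z i \<omega>) ^ 4)"
    and "expectation (\<lambda>\<omega>. (\<Sum>i\<in>I. Z i \<omega>) ^ 4) \<le> real (card I) * w + 3 * (real (card I))\<^sup>2 * v\<^sup>2"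
    by (rule conjunct1, rule conjunct2)
qed

text \<open>Markov's inequality for the fourth power. It serves for the excess over the truncation
  level, whose exponential moments may be infinite.\<close>

lemma indep_sum_fourth_moment_tail:
  fixes Z :: "'i \<Rightarrow> 'a \<Rightarrow> real"
  assumes "finite I" and "indep_vars (\<lambda>_. borel) Z I"
    and "\<And>i. i \<in> I \<Longrightarrow> integrable M (\<lambda>\<omega>. Z i \<omega> ^ 4)"
    and "\<And>i. i \<in> I \<Longrightarrow> expectation (Z i) = 0"
    and "\<And>i. i \<in> I \<Longrightarrow> expectation (\<lambda>\<omega>. (Z i \<omega>)\<^sup>2) = v"
    and "\<And>i. i \<in> I \<Longrightarrow> expectation (\<lambda>\<omega>. Z i \<omega> ^ 4) \<le> w"
    and s: "s > 0"
  shows "prob {\<omega>\<in>space M. (\<Sum>i\<in>I. Z i \<omega>) \<ge> s} \<le> (real (card I) * w + 3 * (real (card I))\<^sup>2 * v\<^sup>2) / s ^ 4"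
proof -
  let ?S = "\<lambda>\<omega>. \<Sum>i\<in>I. Z i \<omega>"
  note F = indep_sum_fourth_moment[OF assms(1-6)]
  have [measurable]: "random_variable borel (Z k)" if "k \<in> I" for k
    using assms(2) that by (auto simp: indep_vars_def)
  have "prob {\<omega>\<in>space M. ?S \<omega> \<ge> s} \<le> prob {\<omega>\<in>space M. ?S \<omega> ^ 4 \<ge> s ^ 4}"
    using s by (intro finite_measure_mono) (auto intro: power_mono)
  also have "\<dots> \<le> expectation (\<lambda>\<omega>. ?S \<omega> ^ 4) / s ^ 4"
    using F(1) s by (intro integral_Markov_inequality_measure[where A = "{}"]) auto
  also have "\<dots> \<le> (real (card I) * w + 3 * (real (card I))\<^sup>2 * v\<^sup>2) / s ^ 4"
    using F(2) s by (intro divide_right_mono) auto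
  finally show ?thesis .
qed

text \<open>Chernoff's bound with the parameter, and its sign, absorbed into \<open>Z\<close>, so
  that upper and lower tails both follow.\<close>

lemma indep_sum_exp_tail:
  fixes Z :: "'i \<Rightarrow> 'a \<Rightarrow> real"
  assumes I: "finite I" and ind: "indep_vars (\<lambda>_. borel) Z I"
    and int: "\<And>i. i \<in> I \<Longrightarrow> integrable M (\<lambda>\<omega>. exp (Z i \<omega>))"
    and le: "\<And>i. i \<in> I \<Longrightarrow> expectation (\<lambda>\<omega>. exp (Z i \<omega>)) \<le> exp b"
  shows "prob {\<omega>\<in>space M. (\<Sum>i\<in>I. Z i \<omega>) \<ge> s} \<le> exp (real (card I) * b - s)"
proof -
  have ind': "indep_vars (\<lambda>_. borel) (\<lambda>i \<omega>. exp (Z i \<omega>)) I"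
    by (rule indep_vars_compose2[OF ind]) simp
  have "prob {\<omega>\<in>space M. (\<Sum>i\<in>I. Z i \<omega>) \<ge> s} = prob {\<omega>\<in>space M. exp (\<Sum>i\<in>I. Z i \<omega>) \<ge> exp s}"
    by simp
  also have "\<dots> = prob {\<omega>\<in>space M. (\<Prod>i\<in>I. exp (Z i \<omega>)) \<ge> exp s}"
    using I by (simp add: exp_sum)
  also have "\<dots> \<le> expectation (\<lambda>\<omega>. \<Prod>i\<in>I. exp (Z i \<omega>)) / exp s"
    using indep_vars_integrable[OF I ind' int]
    by (intro integral_Markov_inequality_measure[where A = "{}"]) (auto intro!: prod_nonneg)
  also have "expectation (\<lambda>\<omega>. \<Prod>i\<in>I. exp (Z i \<omega>)) = (\<Prod>i\<in>I. expectation (\<lambda>\<omega>. exp (Z i \<omega>)))"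
    by (rule indep_vars_lebesgue_integral[OF I ind' int])
  also have "\<dots> \<le> (\<Prod>i\<in>I. exp b)" using le by (intro prod_mono) auto
  also have "\<dots> = exp (real (card I) * b)" by (simp add: exp_of_nat_mult)
  finally show ?thesis by (simp add: exp_diff divide_right_mono)
qed

lemma indep_sum_lower_tail:
  fixes Z :: "'i \<Rightarrow> 'a \<Rightarrow> real"
  assumes I: "finite I" and ind: "indep_vars (\<lambda>_. borel) Z I"
    and pos: "\<And>i. i \<in> I \<Longrightarrow> AE \<omega> in M. 0 \<le> Z i \<omega>"
    and int: "\<And>i. i \<in> I \<Longrightarrow> integrable M (Z i)"
    and int2: "\<And>i. i \<in> I \<Longrightarrow> integrable M (\<lambda>\<omega>. (Z i \<omega>)\<^sup>2)"
    and mean: "\<And>i. i \<in> I \<Longrightarrow> expectation (Z i) \<ge> \<mu>"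
    and sq: "\<And>i. i \<in> I \<Longrightarrow> expectation (\<lambda>\<omega>. (Z i \<omega>)\<^sup>2) \<le> q"
    and l: "l > 0"
  shows "prob {\<omega>\<in>space M. (\<Sum>i\<in>I. Z i \<omega>) \<le> real (card I) * \<mu> - s} \<le> exp (l\<^sup>2 * real (card I) * q / 2 - l * s)"
proof -
  have [measurable]: "random_variable borel (Z k)" if "k \<in> I" for k using int[OF that] by simp
  have ind': "indep_vars (\<lambda>_. borel) (\<lambda>i \<omega>. - l * Z i \<omega>) I"
    by (rule indep_vars_compose2[OF ind]) simp
  have inte: "integrable M (\<lambda>\<omega>. exp (- l * Z i \<omega>))" if i: "i \<in> I" for i
    by (rule integrable_const_bound[where B = 1]) (use pos[OF i] l i in \<open>auto\<close>)
  have le: "expectation (\<lambda>\<omega>. exp (- l * Z i \<omega>)) \<le> exp (- l * \<mu> + l\<^sup>2 * q / 2)" if i: "i \<in> I" for i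
  proof -
    have "expectation (\<lambda>\<omega>. exp (- l * Z i \<omega>)) \<le> expectation (\<lambda>\<omega>. 1 - l * Z i \<omega> + l\<^sup>2 / 2 * (Z i \<omega>)\<^sup>2)"
    proof (intro integral_mono_AE inte i)
      show "AE \<omega> in M. exp (- l * Z i \<omega>) \<le> 1 - l * Z i \<omega> + l\<^sup>2 / 2 * (Z i \<omega>)\<^sup>2"
        using pos[OF i]
      proof eventually_elim
        case (elim \<omega>)
        then show ?case using exp_minus_le[of "l * Z i \<omega>"] l by (simp add: power_mult_distrib)
      qed
    qed (use int[OF i] int2[OF i] in auto)
    also have "\<dots> = 1 - l * expectation (Z i) + l\<^sup>2 / 2 * expectation (\<lambda>\<omega>. (Z i \<omega>)\<^sup>2)"
      using int[OF i] int2[OF i] by (simp add: prob_space)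
    also have "\<dots> \<le> 1 - l * \<mu> + l\<^sup>2 / 2 * q"
      using mean[OF i] sq[OF i] l by (intro add_mono diff_mono mult_left_mono) auto
    also have "\<dots> \<le> exp (- l * \<mu> + l\<^sup>2 * q / 2)"
      by (rule order_trans[OF _ exp_ge_add_one_self]) simp
    finally show ?thesis .
  qed
  have "prob {\<omega>\<in>space M. (\<Sum>i\<in>I. Z i \<omega>) \<le> real (card I) * \<mu> - s} =
        prob {\<omega>\<in>space M. (\<Sum>i\<in>I. - l * Z i \<omega>) \<ge> - l * (real (card I) * \<mu> - s)}"
    using l by (simp add: sum_distrib_left[symmetric] sum_negf)
  also have "\<dots> \<le> exp (real (card I) * (- l * \<mu> + l\<^sup>2 * q / 2) - (- l * (real (card I) * \<mu> - s)))"
    by (rule indep_sum_exp_tail[OF I ind' inte le])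
  also have "\<dots> = exp (l\<^sup>2 * real (card I) * q / 2 - l * s)" by (simp add: algebra_simps)
  finally show ?thesis .
qed

text \<open>Boundedness pays for the exponential moment: \<open>l * t <= 1\<close> keeps
  \<open>l * Z\<close> in the unit interval, where \<open>exp u <= 1 + u + u^2\<close>.\<close>

lemma indep_sum_upper_tail:
  fixes Z :: "'i \<Rightarrow> 'a \<Rightarrow> real"
  assumes I: "finite I" and ind: "indep_vars (\<lambda>_. borel) Z I"
    and pos: "\<And>i. i \<in> I \<Longrightarrow> AE \<omega> in M. 0 \<le> Z i \<omega> \<and> Z i \<omega> \<le> t"
    and int: "\<And>i. i \<in> I \<Longrightarrow> integrable M (Z i)"
    and int2: "\<And>i. i \<in> I \<Longrightarrow> integrable M (\<lambda>\<omega>. (Z i \<omega>)\<^sup>2)"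
    and mean: "\<And>i. i \<in> I \<Longrightarrow> expectation (Z i) \<le> \<mu>"
    and sq: "\<And>i. i \<in> I \<Longrightarrow> expectation (\<lambda>\<omega>. (Z i \<omega>)\<^sup>2) \<le> q"
    and l: "l > 0" "l * t \<le> 1"
  shows "prob {\<omega>\<in>space M. (\<Sum>i\<in>I. Z i \<omega>) \<ge> real (card I) * \<mu> + s} \<le> exp (l\<^sup>2 * real (card I) * q - l * s)"
proof -
  have [measurable]: "random_variable borel (Z k)" if "k \<in> I" for k using int[OF that] by simp
  have ind': "indep_vars (\<lambda>_. borel) (\<lambda>i \<omega>. l * Z i \<omega>) I"
    by (rule indep_vars_compose2[OF ind]) simp
  have lt: "l * z \<le> 1" if "z \<le> t" for z
    using mult_left_mono[OF that, of l] l by linarith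
  have inte: "integrable M (\<lambda>\<omega>. exp (l * Z i \<omega>))" if i: "i \<in> I" for i
    by (rule integrable_const_bound[where B = "exp 1"]) (use pos[OF i] lt i in \<open>auto\<close>)
  have le: "expectation (\<lambda>\<omega>. exp (l * Z i \<omega>)) \<le> exp (l * \<mu> + l\<^sup>2 * q)" if i: "i \<in> I" for i
  proof -
    have "expectation (\<lambda>\<omega>. exp (l * Z i \<omega>)) \<le> expectation (\<lambda>\<omega>. 1 + l * Z i \<omega> + l\<^sup>2 * (Z i \<omega>)\<^sup>2)"
    proof (intro integral_mono_AE inte i)
      show "AE \<omega> in M. exp (l * Z i \<omega>) \<le> 1 + l * Z i \<omega> + l\<^sup>2 * (Z i \<omega>)\<^sup>2"
        using pos[OF i]
      proof eventually_elim
        case (elim \<omega>)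
        then show ?case using exp_bound[of "l * Z i \<omega>"] l lt by (simp add: power_mult_distrib)
      qed
    qed (use int[OF i] int2[OF i] in auto)
    also have "\<dots> = 1 + l * expectation (Z i) + l\<^sup>2 * expectation (\<lambda>\<omega>. (Z i \<omega>)\<^sup>2)"
      using int[OF i] int2[OF i] by (simp add: prob_space)
    also have "\<dots> \<le> 1 + l * \<mu> + l\<^sup>2 * q"
      using mean[OF i] sq[OF i] l by (intro add_mono mult_left_mono) auto
    also have "\<dots> \<le> exp (l * \<mu> + l\<^sup>2 * q)"
      by (rule order_trans[OF _ exp_ge_add_one_self]) simp
    finally show ?thesis .
  qed
  have "prob {\<omega>\<in>space M. (\<Sum>i\<in>I. Z i \<omega>) \<ge> real (card I) * \<mu> + s} =
        prob {\<omega>\<in>space M. (\<Sum>i\<in>I. l * Z i \<omega>) \<ge> l * (real (card I) * \<mu> + s)}"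
    using l by (simp add: sum_distrib_left[symmetric])
  also have "\<dots> \<le> exp (real (card I) * (l * \<mu> + l\<^sup>2 * q) - (l * (real (card I) * \<mu> + s)))"
    by (rule indep_sum_exp_tail[OF I ind' inte le])
  also have "\<dots> = exp (l\<^sup>2 * real (card I) * q - l * s)" by (simp add: algebra_simps)
  finally show ?thesis .
qed

text \<open>Blocks are disjoint, so their centred squared sums are independent and variances add.
  Rows and columns need separate applications, because a row and a column share an entry.\<close>

lemma indep_blocks_square_tail:
  fixes Z :: "'i \<Rightarrow> 'a \<Rightarrow> real" and K :: "'j \<Rightarrow> 'i set"
  assumes J: "finite J" and ind: "indep_vars (\<lambda>_. borel) Z I"
    and K: "\<And>j. j \<in> J \<Longrightarrow> K j \<subseteq> I" "\<And>j. j \<in> J \<Longrightarrow> finite (K j)" "\<And>j. j \<in> J \<Longrightarrow> card (K j) = d"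
    and disj: "disjoint_family_on K J"
    and int: "\<And>i. i \<in> I \<Longrightarrow> integrable M (\<lambda>\<omega>. Z i \<omega> ^ 4)"
    and mean: "\<And>i. i \<in> I \<Longrightarrow> expectation (Z i) = 0"
    and sq: "\<And>i. i \<in> I \<Longrightarrow> expectation (\<lambda>\<omega>. (Z i \<omega>)\<^sup>2) = v"
    and fourth: "\<And>i. i \<in> I \<Longrightarrow> expectation (\<lambda>\<omega>. Z i \<omega> ^ 4) \<le> w"
    and s: "s > 0"
  shows "prob {\<omega>\<in>space M. (\<Sum>j\<in>J. (\<Sum>i\<in>K j. Z i \<omega>)\<^sup>2) \<ge> real (card J) * real d * v + s}
      \<le> real (card J) * (real d * w + 3 * (real d)\<^sup>2 * v\<^sup>2) / s\<^sup>2"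
proof -
  define R where "R = (\<lambda>j \<omega>. \<Sum>i\<in>K j. Z i \<omega>)"
  define T where "T = (\<lambda>j \<omega>. (R j \<omega>)\<^sup>2 - real d * v)"
  have rv: "random_variable borel (Z i)" if "i \<in> I" for i using ind that by (auto simp: indep_vars_def)
  have indK: "indep_vars (\<lambda>_. borel) Z (K j)" if "j \<in> J" for j
    using indep_vars_subset[OF ind K(1)[OF that]] .
  have KI: "i \<in> I" if "j \<in> J" "i \<in> K j" for i j using K(1) that by auto
  have ZI: "integrable M (\<lambda>\<omega>. Z i \<omega> ^ p)" if "i \<in> I" "p \<le> 4" for i p
    by (rule integrable_power_of_fourth[OF rv[OF that(1)] int[OF that(1)] that(2)])
  have ZI1: "integrable M (Z i)" and ZI2: "integrable M (\<lambda>\<omega>. (Z i \<omega>)\<^sup>2)" if "i \<in> I" for i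
    using ZI[OF that, of 1] ZI[OF that, of 2] by simp_all
  have rvR: "random_variable borel (R j)" if "j \<in> J" for j
    unfolding R_def by (rule borel_measurable_sum) (rule rv[OF KI[OF that]])
  have R4: "integrable M (\<lambda>\<omega>. R j \<omega> ^ 4)"
    "expectation (\<lambda>\<omega>. R j \<omega> ^ 4) \<le> real d * w + 3 * (real d)\<^sup>2 * v\<^sup>2" if j: "j \<in> J" for j
    using indep_sum_fourth_moment[OF K(2)[OF j] indK[OF j] int[OF KI[OF j]] mean[OF KI[OF j]] sq[OF KI[OF j]]
        fourth[OF KI[OF j]]]
    unfolding R_def K(3)[OF j] by simp_all
  have R2: "integrable M (\<lambda>\<omega>. (R j \<omega>)\<^sup>2)" if j: "j \<in> J" for j
    by (rule integrable_power_of_fourth[OF rvR[OF j] R4(1)[OF j]]) simp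
  have ER2: "expectation (\<lambda>\<omega>. (R j \<omega>)\<^sup>2) = real d * v" if j: "j \<in> J" for j
    using indep_sum_second_moment(2)[OF K(2)[OF j] indK[OF j] ZI1[OF KI[OF j]]
        ZI2[OF KI[OF j]] mean[OF KI[OF j]]] sq[OF KI[OF j]]
    unfolding R_def by (simp add: K(3)[OF j])
  \<comment> \<open>Each block, restricted to its own indices, is one random element of a product
    space. These elements are independent, and \<open>T j\<close> is a measurable image of the
    \<open>j\<close>-th.\<close>
  have "indep_vars (\<lambda>_. borel) (\<lambda>j \<omega>. ((\<Sum>i\<in>K j. restrict (\<lambda>i. Z i \<omega>) (K j) i)\<^sup>2 - real d * v)) J"
    by (rule indep_vars_compose2[OF indep_vars_restrict[OF ind K(1) disj], where Y = "\<lambda>j f. (\<Sum>i\<in>K j. f i)\<^sup>2 - real d * v"])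
      measurable
  then have indT: "indep_vars (\<lambda>_. borel) T J"
    by (simp add: T_def R_def)
  have T2e: "(T j \<omega>)\<^sup>2 = R j \<omega> ^ 4 - 2 * (real d * v) * (R j \<omega>)\<^sup>2 + (real d * v)\<^sup>2" for j \<omega>
    by (simp add: T_def eval_nat_numeral algebra_simps)
  have T2: "integrable M (\<lambda>\<omega>. (T j \<omega>)\<^sup>2)" if "j \<in> J" for j
    unfolding T2e using R4(1)[OF that] R2[OF that] by auto
  have ET2: "expectation (\<lambda>\<omega>. (T j \<omega>)\<^sup>2) \<le> real d * w + 3 * (real d)\<^sup>2 * v\<^sup>2" if "j \<in> J" for j
  proof -
    have "expectation (\<lambda>\<omega>. (T j \<omega>)\<^sup>2) = expectation (\<lambda>\<omega>. R j \<omega> ^ 4) - (real d * v)\<^sup>2"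
      unfolding T2e using R4(1)[OF that] R2[OF that] ER2[OF that] by (simp add: prob_space power2_eq_square)
    then show ?thesis using R4(2)[OF that] zero_le_power2[of "real d * v"] by linarith
  qed
  have T1: "integrable M (T j)" "expectation (T j) = 0" if "j \<in> J" for j
    unfolding T_def using R2[OF that] ER2[OF that] by (simp_all add: prob_space)
  note S = indep_sum_second_moment[OF J indT T1(1) T2 T1(2)]
  have [measurable]: "random_variable borel (T j)" if "j \<in> J" for j using T1[OF that] by simp
  have "(\<Sum>j\<in>J. (R j \<omega>)\<^sup>2) = (\<Sum>j\<in>J. T j \<omega>) + real (card J) * real d * v" for \<omega>
    by (simp add: T_def sum_subtractf)
  then have "prob {\<omega>\<in>space M. (\<Sum>j\<in>J. (R j \<omega>)\<^sup>2) \<ge> real (card J) * real d * v + s} =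
     prob {\<omega>\<in>space M. (\<Sum>j\<in>J. T j \<omega>) \<ge> s}" by simp
  also have "\<dots> \<le> prob {\<omega>\<in>space M. (\<Sum>j\<in>J. T j \<omega>)\<^sup>2 \<ge> s\<^sup>2}"
    using s by (intro finite_measure_mono) (auto intro: power_mono)
  also have "\<dots> \<le> expectation (\<lambda>\<omega>. (\<Sum>j\<in>J. T j \<omega>)\<^sup>2) / s\<^sup>2"
    using S(1) s by (intro integral_Markov_inequality_measure[where A = "{}"]) auto
  also have "\<dots> \<le> real (card J) * (real d * w + 3 * (real d)\<^sup>2 * v\<^sup>2) / s\<^sup>2"
  proof (rule divide_right_mono)
    have "expectation (\<lambda>\<omega>. (\<Sum>j\<in>J. T j \<omega>)\<^sup>2) = (\<Sum>j\<in>J. expectation (\<lambda>\<omega>. (T j \<omega>)\<^sup>2))" by (rule S(2))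
    also have "\<dots> \<le> real (card J) * (real d * w + 3 * (real d)\<^sup>2 * v\<^sup>2)" by (rule sum_bounded_above[OF ET2])
    finally show "expectation (\<lambda>\<omega>. (\<Sum>j\<in>J. T j \<omega>)\<^sup>2) \<le> real (card J) * (real d * w + 3 * (real d)\<^sup>2 * v\<^sup>2)" .
  qed simp
  finally show ?thesis by (simp add: R_def)
qed

end

section \<open>Square arrays of independent non-negative entries\<close>

locale iid_array = prob_space M + N: prob_space N
  for M :: "'a measure" and N :: "'b measure" +
  fixes x :: "'b \<Rightarrow> real" and n :: nat and Z :: "nat \<times> nat \<Rightarrow> 'a \<Rightarrow> real"
  assumes x_meas [measurable]: "x \<in> borel_measurable N"
    and indep: "indep_vars (\<lambda>_. borel) Z ({..<n} \<times> {..<n})"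
    and distr: "\<And>k. k \<in> {..<n} \<times> {..<n} \<Longrightarrow> distr M borel (Z k) = distr N borel x"
begin

abbreviation "Q \<equiv> {..<n} \<times> {..<n}"

lemma Z_meas: "k \<in> Q \<Longrightarrow> Z k \<in> borel_measurable M"
  using indep by (auto simp: indep_vars_def)

lemma integrable_entry_iff:
  fixes f :: "real \<Rightarrow> real"
  assumes k: "k \<in> Q" and f: "f \<in> borel_measurable borel"
  shows "integrable M (\<lambda>\<omega>. f (Z k \<omega>)) \<longleftrightarrow> integrable N (\<lambda>w. f (x w))"
  using integrable_distr_eq[OF Z_meas[OF k] f] integrable_distr_eq[OF x_meas f] distr[OF k] by simp

lemma expectation_entry:
  fixes f :: "real \<Rightarrow> real"
  assumes k: "k \<in> Q" and f: "f \<in> borel_measurable borel"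
  shows "expectation (\<lambda>\<omega>. f (Z k \<omega>)) = N.expectation (\<lambda>w. f (x w))"
  using integral_distr[OF Z_meas[OF k] f] integral_distr[OF x_meas f] distr[OF k] by simp

lemma AE_entry:
  assumes k: "k \<in> Q" and P: "{y \<in> space borel. P y} \<in> sets borel" and A: "AE w in N. P (x w)"
  shows "AE \<omega> in M. P (Z k \<omega>)"
proof -
  have "AE y in distr N borel x. P y" using A unfolding AE_distr_iff[OF x_meas P] .
  then have "AE y in distr M borel (Z k). P y" by (simp only: distr[OF k])
  then show ?thesis unfolding AE_distr_iff[OF Z_meas[OF k] P] .
qed

lemma indep_image:
  assumes "K \<subseteq> Q" "f \<in> borel_measurable borel"
  shows "indep_vars (\<lambda>_. borel) (\<lambda>k \<omega>. f (Z k \<omega>) :: real) K"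
  by (rule indep_vars_compose2[OF indep_vars_subset[OF indep assms(1)]]) (use assms(2) in simp)

end

section \<open>Truncation of nonnegative entries and the resulting tail bounds\<close>

locale nonneg_iid_array = iid_array M N x n Z
  for M :: "'a measure" and N :: "'b measure" and x :: "'b \<Rightarrow> real" and n :: nat
    and Z :: "nat \<times> nat \<Rightarrow> 'a \<Rightarrow> real" +
  fixes t :: real
  assumes x0: "AE w in N. 0 \<le> x w" and x4: "integrable N (\<lambda>w. x w ^ 4)"
    and t: "t > 0" and n3: "n \<ge> 3"
begin

definition m where "m = N.expectation x"
definition q where "q = N.expectation (\<lambda>w. (x w)\<^sup>2)"
definition v where "v = N.expectation (\<lambda>w. (x w - m)\<^sup>2)"
definition w where "w = N.expectation (\<lambda>w. (x w - m) ^ 4)"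
text \<open>Entries are the sum of a bounded part, treated by exponential tails, and this remainder,
  treated by its fourth moment. \<open>ez\<close>, \<open>vz\<close>, \<open>wz\<close> play for it
  the roles of \<open>m\<close>, \<open>v\<close>, \<open>w\<close>.\<close>

definition excess :: "real \<Rightarrow> real" where "excess y = y - min y t"
definition ez where "ez = N.expectation (\<lambda>w. excess (x w))"
definition vz where "vz = N.expectation (\<lambda>w. (excess (x w) - ez)\<^sup>2)"
definition wz where "wz = N.expectation (\<lambda>w. (excess (x w) - ez) ^ 4)"

lemma excess_meas [measurable]: "excess \<in> borel_measurable borel"
  unfolding excess_def by simp

lemma x_pow: "p \<le> 4 \<Longrightarrow> integrable N (\<lambda>w. x w ^ p)"
  by (rule N.integrable_power_of_fourth[OF x_meas x4])

lemma integrable_fourth_bound: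
  assumes [measurable]: "f \<in> borel_measurable N" and b: "AE w in N. \<bar>f w\<bar> \<le> \<bar>x w\<bar> + a"
  shows "integrable N (\<lambda>w. f w ^ 4 :: real)"
proof (rule Bochner_Integration.integrable_bound)
  show "integrable N (\<lambda>w. 8 * x w ^ 4 + 8 * a ^ 4)" using x4 by simp
  show "AE w in N. norm (f w ^ 4) \<le> norm (8 * x w ^ 4 + 8 * a ^ 4)"
    using b
  proof eventually_elim
    case (elim w)
    have "\<bar>f w\<bar> ^ 4 \<le> (\<bar>x w\<bar> + a) ^ 4" using elim by (intro power_mono) auto
    also have "\<dots> \<le> 8 * \<bar>x w\<bar> ^ 4 + 8 * a ^ 4"
    proof -
      have sq: "(r + s)\<^sup>2 \<le> 2 * r\<^sup>2 + 2 * s\<^sup>2" for r s :: real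
        using zero_le_power2[of "r - s"] by (simp add: power2_eq_square algebra_simps)
      have "(\<bar>x w\<bar> + a) ^ 4 = ((\<bar>x w\<bar> + a)\<^sup>2)\<^sup>2" by simp
      also have "\<dots> \<le> (2 * \<bar>x w\<bar>\<^sup>2 + 2 * a\<^sup>2)\<^sup>2" by (intro power_mono sq) auto
      also have "\<dots> \<le> 2 * (2 * \<bar>x w\<bar>\<^sup>2)\<^sup>2 + 2 * (2 * a\<^sup>2)\<^sup>2" by (rule sq)
      finally show ?thesis by (simp add: power_mult_distrib power_mult[symmetric])
    qed
    finally show ?case by (simp add: power_even_abs power_abs)
  qed
qed auto

lemma trunc_bounds: "AE w in N. 0 \<le> min (x w) t \<and> min (x w) t \<le> t \<and> min (x w) t \<le> x w"
  using x0 by eventually_elim (use t in auto)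

lemma trunc_pow: "p \<le> 4 \<Longrightarrow> integrable N (\<lambda>w. min (x w) t ^ p)"
  by (rule N.integrable_power_of_fourth[OF _ integrable_fourth_bound[where a = 0]])
    (use trunc_bounds in \<open>auto elim!: eventually_mono\<close>)

lemma trunc_mean_le: "N.expectation (\<lambda>w. min (x w) t) \<le> m"
  unfolding m_def using x_pow[of 1] trunc_pow[of 1] trunc_bounds by (intro integral_mono_AE) auto

lemma trunc_mean: "N.expectation (\<lambda>w. min (x w) t) = m - ez"
  unfolding m_def ez_def excess_def using x_pow[of 1] trunc_pow[of 1] by simp

lemma trunc_square_le: "N.expectation (\<lambda>w. (min (x w) t)\<^sup>2) \<le> q"
  unfolding q_def using x_pow[of 2] trunc_pow[of 2] trunc_bounds
  by (intro integral_mono_AE) (auto elim!: eventually_mono intro!: power_mono)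

lemma entry_facts:
  assumes k: "k \<in> Q"
  shows "AE \<omega> in M. 0 \<le> Z k \<omega>"
    "AE \<omega> in M. 0 \<le> min (Z k \<omega>) t \<and> min (Z k \<omega>) t \<le> t"
    "integrable M (Z k)" "integrable M (\<lambda>\<omega>. (Z k \<omega>)\<^sup>2)"
    "integrable M (\<lambda>\<omega>. min (Z k \<omega>) t)" "integrable M (\<lambda>\<omega>. (min (Z k \<omega>) t)\<^sup>2)"
    "expectation (Z k) = m" "expectation (\<lambda>\<omega>. (Z k \<omega>)\<^sup>2) = q"
    "expectation (\<lambda>\<omega>. min (Z k \<omega>) t) = m - ez" "expectation (\<lambda>\<omega>. min (Z k \<omega>) t) \<le> m"
    "expectation (\<lambda>\<omega>. (min (Z k \<omega>) t)\<^sup>2) \<le> q"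
proof -
  show "AE \<omega> in M. 0 \<le> Z k \<omega>" by (rule AE_entry[OF k]) (use x0 in auto)
  then show "AE \<omega> in M. 0 \<le> min (Z k \<omega>) t \<and> min (Z k \<omega>) t \<le> t"
    by eventually_elim (use t in auto)
  show "integrable M (Z k)" "integrable M (\<lambda>\<omega>. (Z k \<omega>)\<^sup>2)"
    using integrable_entry_iff[OF k, of "\<lambda>y. y"] integrable_entry_iff[OF k, of "\<lambda>y. y\<^sup>2"] x_pow[of 1] x_pow[of 2]
    by auto
  show "integrable M (\<lambda>\<omega>. min (Z k \<omega>) t)" "integrable M (\<lambda>\<omega>. (min (Z k \<omega>) t)\<^sup>2)"
    using integrable_entry_iff[OF k, of "\<lambda>y. min y t"] integrable_entry_iff[OF k, of "\<lambda>y. (min y t)\<^sup>2"]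
      trunc_pow[of 1] trunc_pow[of 2] by auto
  show "expectation (Z k) = m" "expectation (\<lambda>\<omega>. (Z k \<omega>)\<^sup>2) = q"
    using expectation_entry[OF k, of "\<lambda>y. y"] expectation_entry[OF k, of "\<lambda>y. y\<^sup>2"] by (auto simp: m_def q_def)
  show "expectation (\<lambda>\<omega>. min (Z k \<omega>) t) = m - ez" "expectation (\<lambda>\<omega>. min (Z k \<omega>) t) \<le> m"
    "expectation (\<lambda>\<omega>. (min (Z k \<omega>) t)\<^sup>2) \<le> q"
    using expectation_entry[OF k, of "\<lambda>y. min y t"] expectation_entry[OF k, of "\<lambda>y. (min y t)\<^sup>2"]
      trunc_mean trunc_mean_le trunc_square_le by auto
qed

lemma centred_facts:
  assumes k: "k \<in> Q"
  shows "integrable M (\<lambda>\<omega>. (Z k \<omega> - m) ^ 4)" "expectation (\<lambda>\<omega>. Z k \<omega> - m) = 0"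
    "expectation (\<lambda>\<omega>. (Z k \<omega> - m)\<^sup>2) = v" "expectation (\<lambda>\<omega>. (Z k \<omega> - m) ^ 4) \<le> w"
    "integrable M (\<lambda>\<omega>. (excess (Z k \<omega>) - ez) ^ 4)" "expectation (\<lambda>\<omega>. excess (Z k \<omega>) - ez) = 0"
    "expectation (\<lambda>\<omega>. (excess (Z k \<omega>) - ez)\<^sup>2) = vz" "expectation (\<lambda>\<omega>. (excess (Z k \<omega>) - ez) ^ 4) \<le> wz"
proof -
  have "integrable N (\<lambda>w. (x w - m) ^ 4)"
    by (rule integrable_fourth_bound[where a = "\<bar>m\<bar>"]) auto
  then show "integrable M (\<lambda>\<omega>. (Z k \<omega> - m) ^ 4)"
    using integrable_entry_iff[OF k, of "\<lambda>y. (y - m) ^ 4"] by simp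
  show "expectation (\<lambda>\<omega>. Z k \<omega> - m) = 0" using entry_facts[OF k] by (simp add: prob_space)
  show "expectation (\<lambda>\<omega>. (Z k \<omega> - m)\<^sup>2) = v" "expectation (\<lambda>\<omega>. (Z k \<omega> - m) ^ 4) \<le> w"
    using expectation_entry[OF k, of "\<lambda>y. (y - m)\<^sup>2"] expectation_entry[OF k, of "\<lambda>y. (y - m) ^ 4"]
    by (auto simp: v_def w_def)
  have "integrable N (\<lambda>w. (excess (x w) - ez) ^ 4)"
    by (rule integrable_fourth_bound[where a = "\<bar>ez\<bar>"])
      (use x0 t in \<open>auto simp: excess_def elim!: eventually_mono\<close>)
  then show "integrable M (\<lambda>\<omega>. (excess (Z k \<omega>) - ez) ^ 4)"
    using integrable_entry_iff[OF k, of "\<lambda>y. (excess y - ez) ^ 4"] by simp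
  have "integrable M (\<lambda>\<omega>. excess (Z k \<omega>))" using entry_facts[OF k] by (simp add: excess_def)
  moreover have "expectation (\<lambda>\<omega>. excess (Z k \<omega>)) = ez"
    using expectation_entry[OF k, of excess] by (simp add: ez_def)
  ultimately show "expectation (\<lambda>\<omega>. excess (Z k \<omega>) - ez) = 0" by (simp add: prob_space)
  show "expectation (\<lambda>\<omega>. (excess (Z k \<omega>) - ez)\<^sup>2) = vz" "expectation (\<lambda>\<omega>. (excess (Z k \<omega>) - ez) ^ 4) \<le> wz"
    using expectation_entry[OF k, of "\<lambda>y. (excess y - ez)\<^sup>2"] expectation_entry[OF k, of "\<lambda>y. (excess y - ez) ^ 4"]
    by (auto simp: vz_def wz_def)
qed

lemma trunc_sum_upper_tail:
  assumes K: "K \<subseteq> Q" and l: "l > 0" "l * t \<le> 1"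
  shows "prob {\<omega>\<in>space M. (\<Sum>k\<in>K. min (Z k \<omega>) t) \<ge> real (card K) * m + s} \<le> exp (l\<^sup>2 * real (card K) * q - l * s)"
proof -
  have fin: "finite K" by (rule finite_subset[OF K]) simp
  have ind: "indep_vars (\<lambda>_. borel) (\<lambda>k \<omega>. min (Z k \<omega>) t) K" by (rule indep_image[OF K]) simp
  note e = entry_facts[OF subsetD[OF K]]
  show ?thesis by (rule indep_sum_upper_tail[OF fin ind e(2) e(5) e(6) e(10) e(11) l])
qed

lemma trunc_sum_lower_tail:
  assumes K: "K \<subseteq> Q" and l: "l > 0" and ez: "ez \<le> m / 2"
  shows "prob {\<omega>\<in>space M. (\<Sum>k\<in>K. min (Z k \<omega>) t) \<le> real (card K) * (m / 2) - s} \<le> exp (l\<^sup>2 * real (card K) * q / 2 - l * s)"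
proof -
  have fin: "finite K" by (rule finite_subset[OF K]) simp
  have ind: "indep_vars (\<lambda>_. borel) (\<lambda>k \<omega>. min (Z k \<omega>) t) K" by (rule indep_image[OF K]) simp
  note e = entry_facts[OF subsetD[OF K]]
  have pos: "AE \<omega> in M. 0 \<le> min (Z k \<omega>) t" if "k \<in> K" for k
    using e(2)[OF that] by eventually_elim simp
  have mean: "m / 2 \<le> expectation (\<lambda>\<omega>. min (Z k \<omega>) t)" if "k \<in> K" for k
    using e(9)[OF that] ez by simp
  show ?thesis by (rule indep_sum_lower_tail[OF fin ind pos e(5) e(6) mean e(11) l])
qed

lemma sum_lower_tail:
  assumes K: "K \<subseteq> Q" and l: "l > 0"
  shows "prob {\<omega>\<in>space M. (\<Sum>k\<in>K. Z k \<omega>) \<le> real (card K) * m - s} \<le> exp (l\<^sup>2 * real (card K) * q / 2 - l * s)"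
proof -
  have fin: "finite K" by (rule finite_subset[OF K]) simp
  note e = entry_facts[OF subsetD[OF K]]
  show ?thesis
    by (rule indep_sum_lower_tail[OF fin indep_vars_subset[OF indep K] e(1) e(3) e(4) eq_refl[OF e(7)[symmetric]] eq_refl[OF e(8)] l])
qed

lemma excess_sum_tail:
  assumes K: "K \<subseteq> Q" and s: "s > 0"
  shows "prob {\<omega>\<in>space M. (\<Sum>k\<in>K. excess (Z k \<omega>) - ez) \<ge> s} \<le> (real (card K) * wz + 3 * (real (card K))\<^sup>2 * vz\<^sup>2) / s ^ 4"
proof -
  have fin: "finite K" by (rule finite_subset[OF K]) simp
  have ind: "indep_vars (\<lambda>_. borel) (\<lambda>k \<omega>. excess (Z k \<omega>) - ez) K" by (rule indep_image[OF K]) simp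
  note c = centred_facts[OF subsetD[OF K]]
  show ?thesis by (rule indep_sum_fourth_moment_tail[OF fin ind c(5) c(6) c(7) c(8) s])
qed

lemma block_square_tail:
  assumes K: "\<And>j. j < n \<Longrightarrow> K j \<subseteq> Q" "\<And>j. j < n \<Longrightarrow> card (K j) = n" and disj: "disjoint_family_on K {..<n}" and s: "s > 0"
  shows "prob {\<omega>\<in>space M. (\<Sum>j<n. (\<Sum>k\<in>K j. Z k \<omega> - m)\<^sup>2) \<ge> (real n)\<^sup>2 * v + s}
      \<le> real n * (real n * w + 3 * (real n)\<^sup>2 * v\<^sup>2) / s\<^sup>2"
proof -
  have ind: "indep_vars (\<lambda>_. borel) (\<lambda>k \<omega>. Z k \<omega> - m) Q" by (rule indep_image[OF subset_refl]) simp
  have 1: "K j \<subseteq> Q" if "j \<in> {..<n}" for j using K(1) that by simp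
  have 2: "finite (K j)" if "j \<in> {..<n}" for j by (rule finite_subset[OF 1[OF that]]) simp
  have 3: "card (K j) = n" if "j \<in> {..<n}" for j using K(2) that by simp
  show ?thesis
    using indep_blocks_square_tail[OF finite_lessThan ind 1 2 3 disj centred_facts(1) centred_facts(2) centred_facts(3) centred_facts(4) s]
    by (simp add: power2_eq_square)
qed

definition row_block :: "nat \<Rightarrow> (nat \<times> nat) set" where "row_block i = {i} \<times> {..<n}"
definition col_block :: "nat \<Rightarrow> (nat \<times> nat) set" where "col_block j = {..<n} \<times> {j}"

lemma block_props:
  "i < n \<Longrightarrow> row_block i \<subseteq> Q" "i < n \<Longrightarrow> col_block i \<subseteq> Q"
  "card (row_block i) = n" "card (col_block i) = n"
  "disjoint_family_on row_block J" "disjoint_family_on col_block J"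
  "(\<Sum>k\<in>row_block i. g k) = (\<Sum>j<n. g (i, j))" "(\<Sum>k\<in>col_block j. g k) = (\<Sum>i<n. g (i, j))"
  for g :: "nat \<times> nat \<Rightarrow> real"
  by (auto simp: row_block_def col_block_def disjoint_family_on_def card_cartesian_product
      sum.cartesian_product')

section \<open>The exceptional events\<close>

definition cuts :: "nat set set" where "cuts = Pow {..<n} - {{}, {..<n}}"

text \<open>The threshold is left as a difference to match \<open>trunc_sum_lower_tail\<close>:
  \<open>m / 2\<close> is a lower bound for the truncated mean, and \<open>m / 4\<close> per entry
  is the tolerated deviation.\<close>

definition small_cut :: "nat set \<Rightarrow> 'a set" where
  "small_cut S = {\<omega>\<in>space M. (\<Sum>k\<in>S \<times> ({..<n} - S). min (Z k \<omega>) t)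
      \<le> real (card (S \<times> ({..<n} - S))) * (m / 2) - real (card (S \<times> ({..<n} - S))) * (m / 4)}"

definition big_trunc :: "(nat \<times> nat) set \<Rightarrow> 'a set" where
  "big_trunc K = {\<omega>\<in>space M. (\<Sum>k\<in>K. min (Z k \<omega>) t) \<ge> real (card K) * m + real n * m / 4096}"

definition small_sum :: "(nat \<times> nat) set \<Rightarrow> 'a set" where
  "small_sum K = {\<omega>\<in>space M. (\<Sum>k\<in>K. Z k \<omega>) \<le> real (card K) * m - real n * m / 4096}"

definition big_excess :: "(nat \<times> nat) set \<Rightarrow> 'a set" where
  "big_excess K = {\<omega>\<in>space M. (\<Sum>k\<in>K. excess (Z k \<omega>) - ez) \<ge> real n * m / 4096}"

definition big_squares :: "(nat \<Rightarrow> (nat \<times> nat) set) \<Rightarrow> 'a set" where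
  "big_squares K = {\<omega>\<in>space M. (\<Sum>j<n. (\<Sum>k\<in>K j. Z k \<omega> - m)\<^sup>2) \<ge> (real n)\<^sup>2 * v + (real n)\<^sup>2 * v * ln (real n)}"

text \<open>The events are one-sided on purpose. The correction term in \<open>gap\<close> suffers
  only from large column sums and small row sums, and Cheeger's inequality asks for upper bounds on
  the truncated sums of both kinds.\<close>

definition bad :: "'a set" where
  "bad = (\<Union>S\<in>cuts. small_cut S) \<union> (\<Union>i<n. big_trunc (row_block i)) \<union> (\<Union>i<n. big_trunc (col_block i))
     \<union> (\<Union>i<n. small_sum (row_block i)) \<union> (\<Union>i<n. big_excess (col_block i))
     \<union> big_squares row_block \<union> big_squares col_block"

lemma event_sets:
  "K \<subseteq> Q \<Longrightarrow> big_trunc K \<in> events" "K \<subseteq> Q \<Longrightarrow> small_sum K \<in> events" "K \<subseteq> Q \<Longrightarrow> big_excess K \<in> events"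
  "S \<in> cuts \<Longrightarrow> small_cut S \<in> events"
  "(\<And>j. j < n \<Longrightarrow> K' j \<subseteq> Q) \<Longrightarrow> big_squares K' \<in> events"
proof -
  have sum: "(\<lambda>\<omega>. \<Sum>k\<in>K. f (Z k \<omega>)) \<in> borel_measurable M"
    if K: "K \<subseteq> Q" and f: "f \<in> borel_measurable borel" for K and f :: "real \<Rightarrow> real"
    by (rule borel_measurable_sum) (rule measurable_compose[OF Z_meas[OF subsetD[OF K]] f])
  have ge: "{\<omega> \<in> space M. c \<le> g \<omega>} \<in> events" and le: "{\<omega> \<in> space M. g \<omega> \<le> c} \<in> events"
    if "g \<in> borel_measurable M" for g :: "'a \<Rightarrow> real" and c
    using that by measurable
  show "big_trunc K \<in> events" if K: "K \<subseteq> Q"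
    unfolding big_trunc_def by (rule ge[OF sum[OF K]]) simp
  show "small_sum K \<in> events" if K: "K \<subseteq> Q"
    unfolding small_sum_def by (rule le[OF sum[OF K, of "\<lambda>y. y"]]) simp
  show "big_excess K \<in> events" if K: "K \<subseteq> Q"
    unfolding big_excess_def by (rule ge[OF sum[OF K]]) simp
  show "small_cut S \<in> events" if S: "S \<in> cuts"
  proof -
    have K: "S \<times> ({..<n} - S) \<subseteq> Q" using S by (auto simp: cuts_def)
    show ?thesis unfolding small_cut_def by (rule le[OF sum[OF K]]) simp
  qed
  show "big_squares K' \<in> events" if K: "\<And>j. j < n \<Longrightarrow> K' j \<subseteq> Q"
  proof -
    have [measurable]: "(\<lambda>\<omega>. \<Sum>k\<in>K' j. Z k \<omega> - m) \<in> borel_measurable M" if "j \<in> {..<n}" for j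
      by (rule sum) (use K that in auto)
    show ?thesis unfolding big_squares_def by (rule ge) measurable
  qed
qed

end

text \<open>The cut bounds give the Poincare constant \<open>n m / 1024\<close>; deviations of size \<open>n m / 4096\<close> in the row and
  column sums cost at most half of it. The factor \<open>2 ^ 28\<close> makes every exponential tail at most
  \<open>n\<close> to the power \<open>-3\<close>, so that a union over rows and columns is still summable in \<open>n\<close>.\<close>

locale regular_array = nonneg_iid_array M N x n Z t
  for M :: "'a measure" and N :: "'b measure" and x :: "'b \<Rightarrow> real" and n :: nat
    and Z :: "nat \<times> nat \<Rightarrow> 'a \<Rightarrow> real" and t :: real +
  fixes C :: real
  assumes m0: "m > 0" and v0: "v > 0" and ez_le: "ez \<le> m / 4096" and C0: "C \<ge> 0"
    and mean_sq_large: "2 ^ 28 * q * ln (real n) \<le> real n * m\<^sup>2"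
    and mean_large: "2 ^ 28 * t * ln (real n) \<le> real n * m"
    and w_le: "w \<le> C * real n * v\<^sup>2" and wz_le: "wz \<le> C * m ^ 4" and vz_le: "vz\<^sup>2 \<le> C * m ^ 4 / real n"
begin

lemma n_pos: "real n > 0" "real n \<ge> 3" using n3 by auto

lemma ln_n: "ln (real n) \<ge> 1"
proof -
  have "exp 1 \<le> real n" using exp_le n_pos(2) by linarith
  then show ?thesis using n_pos(1) by (simp add: ln_ge_iff)
qed

lemma q_pos: "q > 0"
proof -
  have "v = q - m\<^sup>2"
    using N.variance_eq[of x] x_pow[of 1] x_pow[of 2] unfolding v_def q_def m_def by simp
  then show ?thesis using v0 zero_le_power2[of m] by linarith
qed

section \<open>Probability of the exceptional events\<close>

lemma exp_le_inverse_cube: "exp (- s) \<le> 1 / real n ^ 3" if "3 * ln (real n) \<le> s"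
proof -
  have "exp (- s) \<le> exp (- (3 * ln (real n)))" using that by simp
  also have "\<dots> = 1 / exp (ln (real n)) ^ 3"
    by (simp only: exp_minus inverse_eq_divide) (simp add: exp_of_nat_mult[of 3, simplified])
  finally show ?thesis using n_pos(1) by simp
qed

text \<open>The factor in the Chernoff bound for a cut contributed by each vertex on its smaller
  side.\<close>

definition a where "a = exp (- (real n * m\<^sup>2 / (64 * q)))"

lemma a_bounds: "0 < a" "a \<le> 1 / real n ^ 3"
proof -
  show "0 < a" by (simp add: a_def)
  have "3 * ln (real n) \<le> 2 ^ 28 * ln (real n) / 64" using ln_n by simp
  also have "\<dots> = (2 ^ 28 * q * ln (real n)) / (64 * q)" using q_pos by simp
  also have "\<dots> \<le> real n * m\<^sup>2 / (64 * q)" by (intro divide_right_mono mean_sq_large) (use q_pos in simp)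
  finally show "a \<le> 1 / real n ^ 3" unfolding a_def by (rule exp_le_inverse_cube)
qed

text \<open>The larger side has at least \<open>n / 2\<close> vertices, so a cut has at least
  \<open>n / 2\<close> entries for each vertex of the smaller side. This gives \<open>a\<close> to
  the size of the smaller side; adding the power for the other side yields an expression that sums
  by the binomial formula.\<close>

lemma prob_small_cut:
  assumes S: "S \<in> cuts"
  shows "prob (small_cut S) \<le> a ^ card S + a ^ card ({..<n} - S)"
proof -
  define s r where "s = card S" and "r = card ({..<n} - S)"
  define k where "k = card (S \<times> ({..<n} - S))"
  have K: "S \<times> ({..<n} - S) \<subseteq> Q" and Sn: "S \<subseteq> {..<n}" using S by (auto simp: cuts_def)
  have k: "k = s * r" by (simp add: k_def s_def r_def card_cartesian_product)
  have "card {..<n} = s + r"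
    unfolding s_def r_def using card_Un_disjoint[of S "{..<n} - S"] Sn finite_subset[OF Sn]
    by (simp add: Un_absorb1)
  then have n: "n = s + r" by simp
  \<comment> \<open>The minimiser of the exponent
    \<open>l^2 * k * q / 2 - l * k * m / 4\<close>.\<close>
  define l where "l = m / (4 * q)"
  have l: "l > 0" using m0 q_pos by (simp add: l_def)
  have ez2: "ez \<le> m / 2" using ez_le m0 by simp
  have half: "exp (- (real k * m\<^sup>2 / (32 * q))) \<le> a ^ p" if "2 * k \<ge> p * n" for p
  proof -
    have "real p * real n \<le> 2 * real k" using that by (metis of_nat_le_iff of_nat_mult of_nat_numeral)
    then have "(real p * real n) * (m\<^sup>2 / (64 * q)) \<le> (2 * real k) * (m\<^sup>2 / (64 * q))"
      using q_pos by (intro mult_right_mono) auto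
    then have "- (real k * m\<^sup>2 / (32 * q)) \<le> real p * (- (real n * m\<^sup>2 / (64 * q)))" by simp
    then show ?thesis unfolding a_def by (simp add: exp_of_nat_mult[symmetric])
  qed
  have "prob (small_cut S) \<le> exp (l\<^sup>2 * real k * q / 2 - l * (real k * (m / 4)))"
    unfolding small_cut_def k_def using trunc_sum_lower_tail[OF K l ez2] .
  also have "l\<^sup>2 * real k * q / 2 - l * (real k * (m / 4)) = - (real k * m\<^sup>2 / (32 * q))"
    using q_pos by (simp add: l_def power2_eq_square field_simps)
  also have "exp (- (real k * m\<^sup>2 / (32 * q))) \<le> a ^ s + a ^ r"
  proof (cases "s \<le> r")
    case True
    then have "2 * k \<ge> s * n" unfolding k n by (simp add: algebra_simps)
    from half[OF this] show ?thesis using a_bounds(1) zero_less_power[of a r] by linarith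
  next
    case False
    then have "2 * k \<ge> r * n" unfolding k n by (simp add: algebra_simps)
    from half[OF this] show ?thesis using a_bounds(1) zero_less_power[of a s] by linarith
  qed
  finally show ?thesis by (simp add: s_def r_def)
qed

text \<open>There are exponentially many cuts, but the powers of \<open>a\<close> sum over all
  vertex sets to \<open>(1 + a) ^ n\<close>. Without the term 1 this has order \<open>n * a\<close>,
  at most \<open>n^-2\<close>.\<close>

lemma prob_small_cuts: "prob (\<Union>S\<in>cuts. small_cut S) \<le> 4 / (real n)\<^sup>2"
proof -
  have fin: "finite cuts" by (simp add: cuts_def)
  have P1: "(\<Sum>S\<in>Pow {..<n}. a ^ card S) = (a + 1) ^ n"
    using prod_add[of "{..<n}" "\<lambda>_. a" "\<lambda>_. 1"] by simp
  have P2: "(\<Sum>S\<in>Pow {..<n}. a ^ card ({..<n} - S)) = (1 + a) ^ n"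
    using prod_add[of "{..<n}" "\<lambda>_. 1" "\<lambda>_. a"] by simp
  have "prob (\<Union>S\<in>cuts. small_cut S) \<le> (\<Sum>S\<in>cuts. prob (small_cut S))"
    by (intro finite_measure_subadditive_finite fin) (use event_sets(4) in blast)
  also have "\<dots> \<le> (\<Sum>S\<in>cuts. a ^ card S) + (\<Sum>S\<in>cuts. a ^ card ({..<n} - S))"
    unfolding sum.distrib[symmetric] by (intro sum_mono prob_small_cut)
  \<comment> \<open>Each sum omits only the set with exponent zero, which is what removes the 1 from
    \<open>(1 + a) ^ n\<close>. The other trivial set is put back and merely enlarges the
    sum.\<close>
  also have "\<dots> \<le> (\<Sum>S\<in>Pow {..<n} - {{}}. a ^ card S) + (\<Sum>S\<in>Pow {..<n} - {{..<n}}. a ^ card ({..<n} - S))"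
    by (intro add_mono sum_mono2) (use a_bounds(1) in \<open>auto simp: cuts_def\<close>)
  also have "\<dots> = 2 * ((1 + a) ^ n - 1)" by (simp add: sum_diff1 P1 P2 add.commute[of a])
  also have "(1 + a) ^ n \<le> 1 + 2 / (real n)\<^sup>2"
  proof -
    have "(1 + a) ^ n \<le> exp a ^ n" using a_bounds(1) exp_ge_add_one_self[of a] by (intro power_mono) auto
    also have "\<dots> = exp (real n * a)" by (simp add: exp_of_nat_mult)
    also have "\<dots> \<le> exp (1 / (real n)\<^sup>2)"
    proof -
      have "real n * a \<le> real n * (1 / real n ^ 3)" using a_bounds(2) by (intro mult_left_mono) auto
      also have "\<dots> = 1 / (real n)\<^sup>2" using n_pos by (simp add: power2_eq_square power3_eq_cube)
      finally show ?thesis by simp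
    qed
    also have "\<dots> \<le> 1 + 2 / (real n)\<^sup>2"
    proof -
      define u where "u = 1 / (real n)\<^sup>2"
      have "1 \<le> (real n)\<^sup>2" using n_pos by (intro one_le_power) simp
      then have u: "0 \<le> u" "u \<le> 1" by (auto simp: u_def divide_le_eq_1)
      have "u * u \<le> u * 1" using u by (intro mult_left_mono) auto
      then have "exp u \<le> 1 + 2 * u" using exp_bound[OF u] by (simp add: power2_eq_square)
      then show ?thesis by (simp add: u_def)
    qed
    finally show ?thesis .
  qed
  finally show ?thesis by simp
qed

lemma prob_big_trunc:
  assumes K: "K \<subseteq> Q" "card K = n"
  shows "prob (big_trunc K) \<le> 1 / real n ^ 3"
proof -
  \<comment> \<open>The first bound gives \<open>l * t <= 1\<close>. The second makes the quadratic
    term of the exponent at most half of the linear one.\<close>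
  define l where "l = min (1 / t) (m / (8192 * q))"
  have l: "l > 0" using t m0 q_pos by (simp add: l_def)
  have "l * t \<le> (1 / t) * t" using t by (intro mult_right_mono) (auto simp: l_def)
  then have lt: "l * t \<le> 1" using t by simp
  have lq: "l * q \<le> m / 8192"
  proof -
    have "l * q \<le> m / (8192 * q) * q" using q_pos by (intro mult_right_mono) (auto simp: l_def)
    then show ?thesis using q_pos by simp
  qed
  have big: "3 * ln (real n) \<le> l * (real n * m / 8192)"
  proof (cases "1 / t \<le> m / (8192 * q)")
    case True
    have "3 * ln (real n) \<le> 2 ^ 28 * ln (real n) / 8192" using ln_n by simp
    also have "\<dots> = (2 ^ 28 * t * ln (real n)) / (8192 * t)" using t by simp
    also have "\<dots> \<le> (real n * m) / (8192 * t)" using t by (intro divide_right_mono mean_large) auto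
    also have "\<dots> = l * (real n * m / 8192)" using True by (simp add: l_def)
    finally show ?thesis .
  next
    case False
    \<comment> \<open>This is where \<open>2 ^ 28\<close> is tightest: \<open>8192 * 8192\<close> is
      \<open>2 ^ 26\<close>, and the remaining factor 4 exceeds 3.\<close>
    have "3 * ln (real n) \<le> 2 ^ 28 * ln (real n) / (8192 * 8192)" using ln_n by simp
    also have "\<dots> = (2 ^ 28 * q * ln (real n)) / (8192 * 8192 * q)" using q_pos by simp
    also have "\<dots> \<le> (real n * m\<^sup>2) / (8192 * 8192 * q)" using q_pos by (intro divide_right_mono mean_sq_large) auto
    also have "\<dots> = l * (real n * m / 8192)" using False by (simp add: l_def min_def power2_eq_square)
    finally show ?thesis .
  qed
  have "prob (big_trunc K) \<le> exp (l\<^sup>2 * real n * q - l * (real n * m / 4096))"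
    using trunc_sum_upper_tail[OF K(1) l lt, of "real n * m / 4096"] by (simp add: big_trunc_def K(2))
  also have "\<dots> \<le> exp (- (l * (real n * m / 8192)))"
  proof -
    have "l\<^sup>2 * real n * q = (l * real n) * (l * q)" by (simp add: power2_eq_square)
    also have "\<dots> \<le> (l * real n) * (m / 8192)" using lq l by (intro mult_left_mono) auto
    finally show ?thesis by simp
  qed
  also have "\<dots> \<le> 1 / real n ^ 3" by (rule exp_le_inverse_cube[OF big])
  finally show ?thesis .
qed

lemma prob_small_sum:
  assumes K: "K \<subseteq> Q" "card K = n"
  shows "prob (small_sum K) \<le> 1 / real n ^ 3"
proof -
  \<comment> \<open>Again the minimiser of the exponent in the lower tail bound.\<close>
  define l where "l = m / (4096 * q)"
  have l: "l > 0" using m0 q_pos by (simp add: l_def)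
  have "3 * ln (real n) \<le> 2 ^ 28 * ln (real n) / (2 * 4096 * 4096)" using ln_n by simp
  also have "\<dots> = (2 ^ 28 * q * ln (real n)) / (2 * 4096 * 4096 * q)" using q_pos by simp
  also have "\<dots> \<le> (real n * m\<^sup>2) / (2 * 4096 * 4096 * q)" using q_pos by (intro divide_right_mono mean_sq_large) auto
  finally have big: "3 * ln (real n) \<le> (real n * m\<^sup>2) / (2 * 4096 * 4096 * q)" .
  have "prob (small_sum K) \<le> exp (l\<^sup>2 * real n * q / 2 - l * (real n * m / 4096))"
    using sum_lower_tail[OF K(1) l, of "real n * m / 4096"] by (simp add: small_sum_def K(2))
  also have "l\<^sup>2 * real n * q / 2 - l * (real n * m / 4096) = - ((real n * m\<^sup>2) / (2 * 4096 * 4096 * q))"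
    using q_pos by (simp add: l_def power2_eq_square field_simps)
  also have "exp \<dots> \<le> 1 / real n ^ 3" by (rule exp_le_inverse_cube[OF big])
  finally show ?thesis .
qed

text \<open>\<open>wz_le\<close> and \<open>vz_le\<close> bring both terms of the fourth moment to
  order \<open>n * m^4\<close>, against the fourth power of \<open>n * m\<close>. The result
  survives a union over \<open>n\<close> columns.\<close>

lemma prob_big_excess:
  assumes K: "K \<subseteq> Q" "card K = n"
  shows "prob (big_excess K) \<le> 4 * C * 4096 ^ 4 / real n ^ 3"
proof -
  have s: "real n * m / 4096 > 0" using n_pos m0 by simp
  have "prob (big_excess K) \<le> (real n * wz + 3 * (real n)\<^sup>2 * vz\<^sup>2) / (real n * m / 4096) ^ 4"
    using excess_sum_tail[OF K(1) s] by (simp add: big_excess_def K(2))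
  also have "\<dots> \<le> (real n * (C * m ^ 4) + 3 * (real n)\<^sup>2 * (C * m ^ 4 / real n)) / (real n * m / 4096) ^ 4"
    using s by (intro divide_right_mono add_mono mult_left_mono wz_le vz_le) auto
  also have "\<dots> = 4 * (real n * C * m ^ 4) / (real n * m / 4096) ^ 4"
    using n_pos by (simp add: power2_eq_square)
  also have "\<dots> = 4 * C * 4096 ^ 4 / real n ^ 3"
    using n_pos m0 by (simp add: power_divide power_mult_distrib field_simps eval_nat_numeral)
  finally show ?thesis .
qed

text \<open>A deviation of order \<open>n^2 * v\<close> would give a probability bound of order
  \<open>1 / n\<close>, which is not summable. The extra factor \<open>ln n\<close> makes it
  summable, and its square root appears in the final rate.\<close>

lemma prob_big_squares:
  assumes K: "\<And>j. j < n \<Longrightarrow> K j \<subseteq> Q" "\<And>j. j < n \<Longrightarrow> card (K j) = n" and disj: "disjoint_family_on K {..<n}"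
  shows "prob (big_squares K) \<le> (C + 3) / (real n * (ln (real n))\<^sup>2)"
proof -
  have s: "(real n)\<^sup>2 * v * ln (real n) > 0" using n_pos v0 ln_n by (intro mult_pos_pos) auto
  have "prob (big_squares K) \<le> real n * (real n * w + 3 * (real n)\<^sup>2 * v\<^sup>2) / ((real n)\<^sup>2 * v * ln (real n))\<^sup>2"
    using block_square_tail[OF K disj s] by (simp add: big_squares_def)
  also have "\<dots> \<le> real n * (real n * (C * real n * v\<^sup>2) + 3 * (real n)\<^sup>2 * v\<^sup>2) / ((real n)\<^sup>2 * v * ln (real n))\<^sup>2"
    using n_pos by (intro divide_right_mono mult_left_mono add_right_mono w_le) auto
  also have "\<dots> = (C + 3) / (real n * (ln (real n))\<^sup>2)"
    using n_pos v0 ln_n by (simp add: power_mult_distrib field_simps eval_nat_numeral)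
  finally show ?thesis .
qed

lemma prob_Union_blocks:
  assumes "\<And>i. i < n \<Longrightarrow> A i \<in> events" "\<And>i. i < n \<Longrightarrow> prob (A i) \<le> c / real n ^ 3"
  shows "prob (\<Union>i<n. A i) \<le> c / (real n)\<^sup>2"
proof -
  have "prob (\<Union>i<n. A i) \<le> (\<Sum>i<n. prob (A i))"
    by (intro finite_measure_subadditive_finite) (use assms(1) in auto)
  also have "\<dots> \<le> real (card {..<n}) * (c / real n ^ 3)" by (intro sum_bounded_above) (use assms(2) in auto)
  also have "\<dots> = c / (real n)\<^sup>2" using n_pos by (simp add: power2_eq_square power3_eq_cube)
  finally show ?thesis .
qed

lemma bad_event: "bad \<in> events"
  unfolding bad_def
  by (intro sets.Un sets.finite_UN event_sets finite_lessThan) (auto simp: block_props cuts_def)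

lemma prob_bad:
  "prob bad \<le> (7 + 4 * C * 4096 ^ 4) / (real n)\<^sup>2 + 2 * (C + 3) / (real n * (ln (real n))\<^sup>2)"
proof -
  have U: "prob (A \<union> B) \<le> p + r" if "A \<in> events" "B \<in> events" "prob A \<le> p" "prob B \<le> r" for A B p r
    using measure_Un_le[OF that(1,2)] that(3,4) by linarith
  have E1: "(\<Union>S\<in>cuts. small_cut S) \<in> events"
    by (intro sets.finite_UN event_sets(4)) (auto simp: cuts_def)
  have E: "(\<Union>i<n. big_trunc (row_block i)) \<in> events" "(\<Union>i<n. big_trunc (col_block i)) \<in> events"
    "(\<Union>i<n. small_sum (row_block i)) \<in> events" "(\<Union>i<n. big_excess (col_block i)) \<in> events"
    "big_squares row_block \<in> events" "big_squares col_block \<in> events"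
    by (auto intro!: sets.finite_UN event_sets block_props)
  have "prob bad \<le> 4 / (real n)\<^sup>2 + 1 / (real n)\<^sup>2 + 1 / (real n)\<^sup>2 + 1 / (real n)\<^sup>2
      + 4 * C * 4096 ^ 4 / (real n)\<^sup>2 + (C + 3) / (real n * (ln (real n))\<^sup>2) + (C + 3) / (real n * (ln (real n))\<^sup>2)"
    unfolding bad_def
    by (intro U sets.Un E E1 prob_small_cuts prob_Union_blocks prob_big_trunc prob_small_sum prob_big_excess
        prob_big_squares block_props event_sets)
  also have "\<dots> = (7 + 4 * C * 4096 ^ 4) / (real n)\<^sup>2 + 2 * (C + 3) / (real n * (ln (real n))\<^sup>2)"
    by (simp add: add_divide_distrib)
  finally show ?thesis .
qed

section \<open>Consequences for a fixed outcome outside the exceptional events\<close>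

context
  fixes \<omega> assumes \<omega>: "\<omega> \<in> space M" "\<omega> \<notin> bad" and nonneg: "\<And>i j. i < n \<Longrightarrow> j < n \<Longrightarrow> 0 \<le> Z (i, j) \<omega>"
begin

abbreviation "Y i j \<equiv> min (Z (i, j) \<omega>) t"

lemma good_cut:
  assumes S: "S \<subseteq> {..<n}" "S \<noteq> {}" "S \<noteq> {..<n}"
  shows "m / 4 * (real (card S) * real (card ({..<n} - S))) < (\<Sum>i\<in>S. \<Sum>j\<in>{..<n} - S. Y i j)"
proof -
  have "S \<in> cuts" using S by (simp add: cuts_def)
  then have "\<omega> \<notin> small_cut S" using \<omega>(2) unfolding bad_def by blast
  then have "real (card (S \<times> ({..<n} - S))) * (m / 4) < (\<Sum>k\<in>S \<times> ({..<n} - S). min (Z k \<omega>) t)"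
    using \<omega>(1) unfolding small_cut_def by (simp add: not_le algebra_simps)
  then show ?thesis by (simp add: sum.cartesian_product' card_cartesian_product mult.commute)
qed

lemma good_trunc_row: "(\<Sum>j<n. Y i j) < real n * m + real n * m / 4096" if i: "i < n"
proof -
  have "\<omega> \<notin> big_trunc (row_block i)" using \<omega>(2) i unfolding bad_def by blast
  then show ?thesis using \<omega>(1) unfolding big_trunc_def by (simp add: block_props)
qed

lemma good_trunc_col: "(\<Sum>i<n. Y i j) < real n * m + real n * m / 4096" if j: "j < n"
proof -
  have "\<omega> \<notin> big_trunc (col_block j)" using \<omega>(2) j unfolding bad_def by blast
  then show ?thesis using \<omega>(1) unfolding big_trunc_def by (simp add: block_props)
qed

lemma good_row: "real n * m - real n * m / 4096 < (\<Sum>j<n. Z (i, j) \<omega>)" if i: "i < n"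
proof -
  have "\<omega> \<notin> small_sum (row_block i)" using \<omega>(2) i unfolding bad_def by blast
  then show ?thesis using \<omega>(1) unfolding small_sum_def by (simp add: block_props)
qed

text \<open>The three units of \<open>n * m / 4096\<close> are the deviation of the truncated sum,
  the mean of the excess and the deviation of the excess.\<close>

lemma good_col: "(\<Sum>i<n. Z (i, j) \<omega>) < real n * m + 3 * (real n * m / 4096)" if j: "j < n"
proof -
  have "\<omega> \<notin> big_excess (col_block j)" using \<omega>(2) j unfolding bad_def by blast
  then have "(\<Sum>i<n. excess (Z (i, j) \<omega>)) - real n * ez < real n * m / 4096"
    using \<omega>(1) unfolding big_excess_def by (simp add: block_props sum_subtractf)
  moreover have "real n * ez \<le> real n * (m / 4096)" using ez_le by (intro mult_left_mono) auto
  moreover have "(\<Sum>i<n. Z (i, j) \<omega>) = (\<Sum>i<n. Y i j) + (\<Sum>i<n. excess (Z (i, j) \<omega>))"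
    unfolding sum.distrib[symmetric] by (simp add: excess_def)
  ultimately show ?thesis using good_trunc_col[OF j] by simp
qed

text \<open>Cheeger's inequality is applied to the truncated weights, whose row and column sums are
  bounded. The Dirichlet form is monotone in the weights, so the bound carries over to the entries
  themselves.\<close>

lemma good_poincare:
  assumes f: "(\<Sum>i<n. f i) = 0"
  shows "real n * m / 512 * (\<Sum>i<n. (f i)\<^sup>2) \<le> (\<Sum>i<n. \<Sum>j<n. Z (i, j) \<omega> * (f i - f j)\<^sup>2)"
proof -
  define E where "E = (\<Sum>i<n. \<Sum>j<n. Y i j * (f i - f j)\<^sup>2)"
  have nm: "real n * m > 0" using n_pos m0 by simp
  \<comment> \<open>A set \<open>S\<close> of at most half of the vertices has a complement of size
    at least \<open>n / 2\<close>, so \<open>m / 4\<close> per entry gives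
    \<open>h = n * m / 8\<close>. With \<open>C = 2 * n * m\<close>, \<open>h^2 / (4 * C)\<close> is
    \<open>n * m / 512\<close>.\<close>
  have "(real n * m / 8)\<^sup>2 * (\<Sum>i<n. (f i)\<^sup>2) \<le> 4 * (2 * (real n * m)) * E"
    unfolding E_def
  proof (rule cheeger_poincare[OF finite_lessThan _ _ _ _ _ _ f])
    fix S assume S: "S \<subseteq> {..<n}" "S \<noteq> {}" "2 * card S \<le> card {..<n}"
    then have ne: "S \<noteq> {..<n}" using n3 by auto
    have c: "card ({..<n} - S) = n - card S" using S finite_subset[OF S(1)] by (simp add: card_Diff_subset)
    have "real n / 2 \<le> real (card ({..<n} - S))" using S(3) by (simp add: c)
    then have "m / 4 * (real (card S) * (real n / 2)) \<le> m / 4 * (real (card S) * real (card ({..<n} - S)))"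
      using m0 by (intro mult_left_mono) auto
    also have "\<dots> < (\<Sum>i\<in>S. \<Sum>j\<in>{..<n} - S. Y i j)" by (rule good_cut[OF S(1,2) ne])
    finally show "real n * m / 8 * real (card S) \<le> (\<Sum>i\<in>S. \<Sum>j\<in>{..<n} - S. Y i j)" by (simp add: mult_ac)
  next
    fix i assume "i \<in> {..<n}"
    then have i: "i < n" by simp
    show "(\<Sum>j<n. Y i j) \<le> 2 * (real n * m)" using good_trunc_row[OF i] nm by linarith
    show "(\<Sum>j<n. Y j i) \<le> 2 * (real n * m)" using good_trunc_col[OF i] nm by linarith
  qed (use nm nonneg t in auto)
  then have "(real n * m) * (real n * m / 512 * (\<Sum>i<n. (f i)\<^sup>2)) \<le> (real n * m) * E"
    by (simp add: power2_eq_square)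
  then have "real n * m / 512 * (\<Sum>i<n. (f i)\<^sup>2) \<le> E" using nm by (simp only: mult_le_cancel_left_pos)
  also have "E \<le> (\<Sum>i<n. \<Sum>j<n. Z (i, j) \<omega> * (f i - f j)\<^sup>2)"
    unfolding E_def by (intro sum_mono mult_right_mono) auto
  finally show ?thesis .
qed

lemma good_rates: "nonneg_rates n (\<lambda>i j. Z (i, j) \<omega>) (real n * m / 2048)"
proof
  show "2 \<le> n" using n3 by simp
  show "0 < real n * m / 2048" using n_pos m0 by simp
  show "0 \<le> Z (i, j) \<omega>" if "i < n" "j < n" for i j using nonneg that by simp
next
  fix S assume S: "S \<subseteq> {..<n}" "S \<noteq> {}" "S \<noteq> {..<n}"
  show "\<exists>i\<in>S. \<exists>j\<in>{..<n} - S. 0 < Z (i, j) \<omega>"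
  proof (rule ccontr)
    assume "\<not> ?thesis"
    then have "(\<Sum>i\<in>S. \<Sum>j\<in>{..<n} - S. Y i j) \<le> 0"
      by (intro sum_nonpos) (meson min.coboundedI1 not_le)
    moreover have "0 \<le> m / 4 * (real (card S) * real (card ({..<n} - S)))" using m0 by simp
    ultimately show False using good_cut[OF S] by linarith
  qed
next
  fix f :: "nat \<Rightarrow> real" assume f: "(\<Sum>i<n. f i) = 0"
  have "(\<Sum>j<n. (f j)\<^sup>2 * ((\<Sum>i<n. Z (i, j) \<omega>) - (\<Sum>i<n. Z (j, i) \<omega>))) \<le> (\<Sum>j<n. (f j)\<^sup>2 * (real n * m / 1024))"
  proof (intro sum_mono mult_left_mono)
    fix j assume "j \<in> {..<n}"
    then have j: "j < n" by simp
    \<comment> \<open>Four units of \<open>n * m / 4096\<close>: one from the row, three from the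
      column.\<close>
    show "(\<Sum>i<n. Z (i, j) \<omega>) - (\<Sum>i<n. Z (j, i) \<omega>) \<le> real n * m / 1024"
      using good_row[OF j] good_col[OF j] by simp
  qed simp
  also have "\<dots> = real n * m * (\<Sum>i<n. (f i)\<^sup>2) / 1024"
    by (simp add: sum_distrib_left sum_divide_distrib mult_ac)
  finally show "real n * m / 2048 * (\<Sum>i<n. (f i)\<^sup>2) \<le> (\<Sum>i<n. \<Sum>j<n. Z (i, j) \<omega> * (f i - f j)\<^sup>2) / 2 -
      (\<Sum>j<n. (f j)\<^sup>2 * ((\<Sum>i<n. Z (i, j) \<omega>) - (\<Sum>i<n. Z (j, i) \<omega>))) / 2"
    using good_poincare[OF f] by simp
qed

lemma good_squares: "(\<Sum>j<n. ((\<Sum>i<n. Z (i, j) \<omega>) - (\<Sum>i<n. Z (j, i) \<omega>))\<^sup>2) \<le> 8 * (real n)\<^sup>2 * v * ln (real n)"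
proof -
  have "\<omega> \<notin> big_squares row_block" "\<omega> \<notin> big_squares col_block" using \<omega>(2) unfolding bad_def by blast+
  then have b: "(\<Sum>j<n. ((\<Sum>i<n. Z (j, i) \<omega>) - real n * m)\<^sup>2) < (real n)\<^sup>2 * v + (real n)\<^sup>2 * v * ln (real n)"
    "(\<Sum>j<n. ((\<Sum>i<n. Z (i, j) \<omega>) - real n * m)\<^sup>2) < (real n)\<^sup>2 * v + (real n)\<^sup>2 * v * ln (real n)"
    using \<omega>(1) unfolding big_squares_def by (simp_all add: block_props sum_subtractf)
  have "(\<Sum>j<n. ((\<Sum>i<n. Z (i, j) \<omega>) - (\<Sum>i<n. Z (j, i) \<omega>))\<^sup>2) \<le>
     (\<Sum>j<n. 2 * ((\<Sum>i<n. Z (i, j) \<omega>) - real n * m)\<^sup>2 + 2 * ((\<Sum>i<n. Z (j, i) \<omega>) - real n * m)\<^sup>2)"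
  proof (rule sum_mono)
    fix j
    have "(r - s)\<^sup>2 \<le> 2 * (r - u)\<^sup>2 + 2 * (s - u)\<^sup>2" for r s u :: real
      using zero_le_power2[of "r + s - 2 * u"] by (simp add: power2_eq_square algebra_simps)
    then show "((\<Sum>i<n. Z (i, j) \<omega>) - (\<Sum>i<n. Z (j, i) \<omega>))\<^sup>2 \<le>
      2 * ((\<Sum>i<n. Z (i, j) \<omega>) - real n * m)\<^sup>2 + 2 * ((\<Sum>i<n. Z (j, i) \<omega>) - real n * m)\<^sup>2" .
  qed
  also have "\<dots> \<le> 4 * ((real n)\<^sup>2 * v + (real n)\<^sup>2 * v * ln (real n))"
    using b by (simp add: sum.distrib sum_distrib_left[symmetric])
  also have "\<dots> \<le> 8 * (real n)\<^sup>2 * v * ln (real n)"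
  proof -
    have "(real n)\<^sup>2 * v * 1 \<le> (real n)\<^sup>2 * v * ln (real n)" using v0 ln_n by (intro mult_left_mono) auto
    then show ?thesis by (simp add: algebra_simps)
  qed
  finally show ?thesis .
qed

lemma good_conclusion:
  defines "L \<equiv> markov_generator (mat n n (\<lambda>(i, j). Z (i, j) \<omega>))"
  shows "irreducible_generator L" "\<exists>!P. is_invariant_measure L P"
    "tv_norm (invariant_measure L - uniform_vec n) \<le> 4096 * (sqrt v / m * sqrt (ln (real n) / real n))"
proof -
  interpret R: nonneg_rates n "\<lambda>i j. Z (i, j) \<omega>" "real n * m / 2048" by (rule good_rates)
  have G: "R.G = L" by (simp add: R.G_def L_def)
  show "irreducible_generator L" "\<exists>!P. is_invariant_measure L P"
    using R.irreducible R.ex1_invariant unfolding G .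
  have "tv_norm (invariant_measure L - uniform_vec n) \<le>
      sqrt ((\<Sum>j<n. ((\<Sum>i<n. Z (i, j) \<omega>) - (\<Sum>i<n. Z (j, i) \<omega>))\<^sup>2) / real n) / (2 * (real n * m / 2048))"
    using R.tv_invariant_uniform unfolding G .
  \<comment> \<open>The 8 of \<open>good_squares\<close> is relaxed to 16 so that the root comes out
    as \<open>4 * n\<close>; dividing by \<open>2 * (n * m / 2048)\<close> gives
    \<open>4096 / m\<close>.\<close>
  also have "\<dots> \<le> sqrt (16 * (real n)\<^sup>2 * v * ln (real n) / real n) / (2 * (real n * m / 2048))"
  proof (intro divide_right_mono real_sqrt_le_mono)
    have "0 \<le> (real n)\<^sup>2 * v * ln (real n)" using v0 ln_n by simp
    then show "(\<Sum>j<n. ((\<Sum>i<n. Z (i, j) \<omega>) - (\<Sum>i<n. Z (j, i) \<omega>))\<^sup>2) \<le> 16 * (real n)\<^sup>2 * v * ln (real n)"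
      using good_squares by linarith
  qed (use n_pos m0 in auto)
  also have "16 * (real n)\<^sup>2 * v * ln (real n) / real n = (4 * real n)\<^sup>2 * (v * (ln (real n) / real n))"
    by (simp add: power2_eq_square)
  also have "sqrt \<dots> = 4 * real n * (sqrt v * sqrt (ln (real n) / real n))"
    by (simp only: real_sqrt_mult[of "(4 * real n)\<^sup>2"] real_sqrt_mult[of v] real_sqrt_abs)
  also have "\<dots> / (2 * (real n * m / 2048)) = 4096 * (sqrt v / m * sqrt (ln (real n) / real n))"
    using n_pos m0 by simp
  finally show "tv_norm (invariant_measure L - uniform_vec n) \<le> 4096 * (sqrt v / m * sqrt (ln (real n) / real n))" .
qed

end

end

section \<open>Verification for the two families of laws\<close>

text \<open>Comparison with the telescoping differences \<open>1 / ln (r - 1) - 1 / ln r\<close>,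
  using \<open>ln r - ln (r - 1) >= 1 / r\<close>. The shift by 3 keeps both logarithms
  positive.\<close>

lemma summable_inverse_n_ln_squared: "summable (\<lambda>n. 1 / (real n * (ln (real n))\<^sup>2))"
proof -
  have "(\<lambda>n. 1 / ln (real n + 2)) \<longlonglongrightarrow> 0" by real_asymp
  then have S: "summable (\<lambda>n. 1 / ln (real n + 2) - 1 / ln (real (Suc n) + 2))"
    by (rule telescope_summable')
  have "summable (\<lambda>n. 1 / (real (n + 3) * (ln (real (n + 3)))\<^sup>2))"
  proof (rule summable_comparison_test'[OF S])
    fix n :: nat
    define r where "r = real n + 3"
    have r: "r \<ge> 3" by (simp add: r_def)
    have l1: "0 < ln (r - 1)" and l2: "0 < ln r" and le: "ln (r - 1) \<le> ln r" using r by auto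
    have "1 / r \<le> ln r - ln (r - 1)"
    proof -
      have "ln ((r - 1) / r) \<le> (r - 1) / r - 1" using r by (intro ln_le_minus_one) auto
      then show ?thesis using r by (simp add: ln_div field_simps)
    qed
    then have "(1 / r) / (ln r * ln r) \<le> (ln r - ln (r - 1)) / (ln (r - 1) * ln r)"
      using l1 l2 le r by (intro frac_le mult_right_mono mult_pos_pos) auto
    also have "\<dots> = 1 / ln (r - 1) - 1 / ln r" using l1 l2 by (simp add: field_simps)
    finally have "1 / (r * (ln r)\<^sup>2) \<le> 1 / ln (r - 1) - 1 / ln r" by (simp add: power2_eq_square)
    moreover have e: "real n + 2 = r - 1" "real (Suc n) + 2 = r" "real (n + 3) = r" by (simp_all add: r_def)
    ultimately show "norm (1 / (real (n + 3) * (ln (real (n + 3)))\<^sup>2)) \<le> 1 / ln (real n + 2) - 1 / ln (real (Suc n) + 2)"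
      unfolding e using r by simp
  qed
  then show ?thesis by (simp only: summable_iff_shift[of "\<lambda>n. 1 / (real n * (ln (real n))\<^sup>2)" 3])
qed

lemma (in prob_space) expectation_pos_if_variance_pos:
  fixes X :: "'a \<Rightarrow> real"
  assumes X: "integrable M X" "AE \<omega> in M. 0 \<le> X \<omega>" and v: "variance X > 0"
  shows "expectation X > 0"
proof (rule ccontr)
  assume "\<not> ?thesis"
  then have e: "expectation X = 0" using integral_nonneg_AE[OF X(2)] by simp
  then have "AE \<omega> in M. X \<omega> = 0" using integral_nonneg_eq_0_iff_AE[OF X] by simp
  then have "AE \<omega> in M. (X \<omega> - expectation X)\<^sup>2 = 0" unfolding e by eventually_elim simp
  then have "variance X = 0" by (rule integral_eq_zero_AE)
  then show False using v by simp
qed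

section \<open>Moment bounds for the excess\<close>

context nonneg_iid_array
begin

text \<open>The third bound is the gain from truncation: the excess vanishes unless
  \<open>y > t\<close>, so it is at most \<open>y^2 / t\<close>. This makes \<open>ez\<close> of
  order \<open>1 / t\<close> and \<open>vz\<close> of order \<open>1 / t^2\<close>.\<close>

lemma excess_bounds:
  assumes "0 \<le> y"
  shows "0 \<le> excess y" "excess y \<le> y" "excess y * t \<le> y\<^sup>2"
proof -
  show b: "0 \<le> excess y" "excess y \<le> y" using assms t by (auto simp: excess_def)
  show "excess y * t \<le> y\<^sup>2"
  proof (cases "y \<le> t")
    case False
    then have "excess y * t \<le> y * y" using b assms t by (intro mult_mono) auto
    then show ?thesis by (simp add: power2_eq_square)
  qed (simp add: excess_def)
qed

lemma excess_pow: "p \<le> 4 \<Longrightarrow> integrable N (\<lambda>w. excess (x w) ^ p)"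
proof (rule N.integrable_power_of_fourth)
  show "integrable N (\<lambda>w. excess (x w) ^ 4)"
  proof (rule integrable_fourth_bound[where a = 0])
    show "AE w in N. \<bar>excess (x w)\<bar> \<le> \<bar>x w\<bar> + 0"
      using x0 by eventually_elim (use excess_bounds in auto)
  qed simp
qed simp

lemma ez_nonneg: "0 \<le> ez"
  unfolding ez_def
proof (rule integral_nonneg_AE)
  show "AE w in N. 0 \<le> excess (x w)" using x0 by eventually_elim (rule excess_bounds)
qed

lemma ez_le_mean: "ez \<le> m"
  unfolding ez_def m_def
proof (rule integral_mono_AE)
  show "AE w in N. excess (x w) \<le> x w" using x0 by eventually_elim (rule excess_bounds)
qed (use excess_pow[of 1] x_pow[of 1] in simp_all)

lemma ez_truncation_bound: "ez \<le> q / t"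
proof -
  have "ez \<le> N.expectation (\<lambda>w. (x w)\<^sup>2 / t)"
    unfolding ez_def
  proof (rule integral_mono_AE)
    show "AE w in N. excess (x w) \<le> (x w)\<^sup>2 / t" using x0
    proof eventually_elim
      case (elim w) then show ?case using excess_bounds(3)[of "x w"] t by (simp add: pos_le_divide_eq)
    qed
  qed (use excess_pow[of 1] x_pow[of 2] in simp_all)
  then show ?thesis by (simp add: q_def)
qed

lemma vz_truncation_bound: "0 \<le> vz" "vz \<le> N.expectation (\<lambda>w. x w ^ 4) / t\<^sup>2"
proof -
  show "0 \<le> vz" unfolding vz_def by (rule integral_nonneg_AE) simp
  have i: "integrable N (\<lambda>w. excess (x w))" "integrable N (\<lambda>w. (excess (x w))\<^sup>2)"
    using excess_pow[of 1] excess_pow[of 2] by simp_all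
  have "vz = N.expectation (\<lambda>w. (excess (x w))\<^sup>2) - ez\<^sup>2"
    unfolding vz_def ez_def using N.variance_eq[OF i] .
  also have "\<dots> \<le> N.expectation (\<lambda>w. (excess (x w))\<^sup>2)" by simp
  also have "\<dots> \<le> N.expectation (\<lambda>w. x w ^ 4 / t\<^sup>2)"
  proof (rule integral_mono_AE)
    show "AE w in N. (excess (x w))\<^sup>2 \<le> x w ^ 4 / t\<^sup>2" using x0
    proof eventually_elim
      case (elim w)
      have "(excess (x w) * t)\<^sup>2 \<le> ((x w)\<^sup>2)\<^sup>2"
        using excess_bounds[OF elim] t by (intro power_mono) auto
      then show ?case using t by (simp add: pos_le_divide_eq power_mult_distrib)
    qed
  qed (use i x4 in simp_all)
  finally show "vz \<le> N.expectation (\<lambda>w. x w ^ 4) / t\<^sup>2" by simp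
qed

lemma wz_bound: "wz \<le> 8 * N.expectation (\<lambda>w. x w ^ 4) + 8 * m ^ 4"
proof -
  have "wz \<le> N.expectation (\<lambda>w. 8 * x w ^ 4 + 8 * m ^ 4)"
    unfolding wz_def
  proof (rule integral_mono_AE)
    show "integrable N (\<lambda>w. (excess (x w) - ez) ^ 4)"
    proof (rule integrable_fourth_bound[where a = "\<bar>ez\<bar>"])
      show "AE w in N. \<bar>excess (x w) - ez\<bar> \<le> \<bar>x w\<bar> + \<bar>ez\<bar>"
        using x0
      proof eventually_elim
        case (elim w) then show ?case using excess_bounds[of "x w"] by linarith
      qed
    qed simp
    show "AE w in N. (excess (x w) - ez) ^ 4 \<le> 8 * x w ^ 4 + 8 * m ^ 4"
      using x0
    proof eventually_elim
      case (elim w)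
      \<comment> \<open>The excess lies between 0 and \<open>x w\<close>, and \<open>ez\<close>
        between 0 and \<open>m\<close>, so their difference cannot exceed the larger of the two in
        absolute value.\<close>
      have "\<bar>excess (x w) - ez\<bar> \<le> max (x w) m"
        using excess_bounds[OF elim] ez_nonneg ez_le_mean by linarith
      then have "\<bar>excess (x w) - ez\<bar> ^ 4 \<le> max (x w) m ^ 4" by (intro power_mono) auto
      also have "\<dots> \<le> 8 * x w ^ 4 + 8 * m ^ 4"
        using zero_le_even_power[of 4 "x w"] zero_le_even_power[of 4 m] by (simp add: max_def)
      finally show ?case by (simp add: power_even_abs)
    qed
  qed (use x4 in simp_all)
  then show ?thesis using x4 by (simp add: N.prob_space)
qed

end

text \<open>The convergence half of Borel-Cantelli sees only the probabilities of the events, so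
  arrays of different sizes may be coupled in any way. The level \<open>t\<close> may vary with
  \<open>n\<close>, but \<open>C\<close> may not, since it multiplies the summable bound.\<close>

lemma regular_arrays_conclusion:
  fixes M :: "'a measure" and N :: "'b measure" and x :: "nat \<Rightarrow> 'b \<Rightarrow> real"
    and X :: "nat \<Rightarrow> nat \<Rightarrow> nat \<Rightarrow> 'a \<Rightarrow> real"
  assumes ev: "\<forall>\<^sub>F n in sequentially. regular_array M N (x n) n (\<lambda>(i, j). X n i j) (t n) C"
  defines "L \<equiv> \<lambda>n \<omega>. markov_generator (mat n n (\<lambda>(i, j). X n i j \<omega>))"
  shows "AE \<omega> in M. \<forall>\<^sub>F n in sequentially. irreducible_generator (L n \<omega>) \<and>
     (\<exists>!P. is_invariant_measure (L n \<omega>) P) \<and>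
     tv_norm (invariant_measure (L n \<omega>) - uniform_vec n)
       \<le> 4096 * (std_dev N (x n) / mean N (x n) * sqrt (ln (real n) / real n))"
proof -
  obtain n0 where n0: "\<And>n. n \<ge> n0 \<Longrightarrow> regular_array M N (x n) n (\<lambda>(i, j). X n i j) (t n) C"
    using ev unfolding eventually_sequentially by blast
  interpret M: prob_space M
    using n0[of n0] by (auto simp: regular_array_def nonneg_iid_array_def iid_array_def)
  \<comment> \<open>Below \<open>n0\<close> regularity is not known, so the empty set stands in for
    the exceptional event.\<close>
  define B where "B = (\<lambda>n. if n \<ge> n0 then nonneg_iid_array.bad M N (x n) n (\<lambda>(i, j). X n i j) (t n) else {})"
  define b where "b = (\<lambda>n. (7 + 4 * C * 4096 ^ 4) / (real n)\<^sup>2 + 2 * (C + 3) / (real n * (ln (real n))\<^sup>2))"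
  have B_sets: "B n \<in> sets M" for n
    using regular_array.bad_event[OF n0] by (simp add: B_def)
  have "summable b"
  proof -
    have "summable (\<lambda>n. (7 + 4 * C * 4096 ^ 4) * (1 / (real n)\<^sup>2) + 2 * (C + 3) * (1 / (real n * (ln (real n))\<^sup>2)))"
      using inverse_power_summable[of 2, where 'a = real]
      by (intro summable_add summable_mult summable_inverse_n_ln_squared) (simp add: inverse_eq_divide)
    then show ?thesis by (simp add: b_def)
  qed
  then have "summable (\<lambda>n. measure M (B n))"
  proof (rule summable_comparison_test_ev[rotated])
    show "\<forall>\<^sub>F n in sequentially. norm (measure M (B n)) \<le> b n"
      using eventually_ge_at_top[of n0]
    proof eventually_elim
      case (elim n)
      then show ?case using regular_array.prob_bad[OF n0[OF elim]] by (simp add: B_def b_def)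
    qed
  qed
  then have AE1: "AE \<omega> in M. \<forall>\<^sub>F n in sequentially. \<omega> \<in> space M - B n"
    by (intro borel_cantelli_AE1 B_sets) (simp_all add: less_top[symmetric])
  \<comment> \<open>Entries are nonnegative only almost surely; as there are countably many over all
    sizes, one null set suffices.\<close>
  have "AE \<omega> in M. n \<ge> n0 \<longrightarrow> i < n \<longrightarrow> j < n \<longrightarrow> 0 \<le> X n i j \<omega>" for n i j
  proof (cases "n \<ge> n0 \<and> i < n \<and> j < n")
    case True
    then interpret R: regular_array M N "x n" n "\<lambda>(i, j). X n i j" "t n" C using n0 by blast
    show ?thesis using R.entry_facts(1)[of "(i, j)"] True by (auto elim: eventually_mono)
  qed auto
  then have AE2: "AE \<omega> in M. \<forall>n i j. n \<ge> n0 \<longrightarrow> i < n \<longrightarrow> j < n \<longrightarrow> 0 \<le> X n i j \<omega>"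
    by (simp add: AE_all_countable)
  show ?thesis
    using AE1 AE2
  proof eventually_elim
    case (elim \<omega>)
    from elim(1) eventually_ge_at_top[of n0] show ?case
    proof eventually_elim
      case (elim n)
      interpret R: regular_array M N "x n" n "\<lambda>(i, j). X n i j" "t n" C using n0 elim(2) by blast
      have g: "\<omega> \<in> space M" "\<omega> \<notin> R.bad" using elim by (auto simp: B_def)
      have nn: "0 \<le> (case (i, j) of (i, j) \<Rightarrow> X n i j) \<omega>" if "i < n" "j < n" for i j
        using \<open>\<forall>n i j. n \<ge> n0 \<longrightarrow> i < n \<longrightarrow> j < n \<longrightarrow> 0 \<le> X n i j \<omega>\<close> that elim(2) by simp
      have "R.m = mean N (x n)" "sqrt R.v = std_dev N (x n)"
        by (simp_all add: R.m_def R.v_def mean_def std_dev_def)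
      moreover have "markov_generator (mat n n (\<lambda>(i, j). (case (i, j) of (i, j) \<Rightarrow> X n i j) \<omega>)) = L n \<omega>"
        by (simp add: L_def)
      ultimately show ?case using R.good_conclusion[OF g nn] by simp
    qed
  qed
qed


section \<open>Regularity of the fixed and of the sparse law\<close>

locale iid_arrays = prob_space M + N: prob_space N
  for M :: "'a measure" and N :: "'b measure" +
  fixes x :: "nat \<Rightarrow> 'b \<Rightarrow> real" and X :: "nat \<Rightarrow> nat \<Rightarrow> nat \<Rightarrow> 'a \<Rightarrow> real"
  assumes x_meas: "\<And>n. n \<ge> 1 \<Longrightarrow> x n \<in> borel_measurable N"
    and indep: "\<And>n. n \<ge> 1 \<Longrightarrow> indep_vars (\<lambda>_. borel) (\<lambda>(i, j). X n i j) ({..<n} \<times> {..<n})"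
    and distr: "\<And>n i j. n \<ge> 1 \<Longrightarrow> i < n \<Longrightarrow> j < n \<Longrightarrow> distr M borel (X n i j) = distr N borel (x n)"
begin

lemma nonneg_array:
  assumes "n \<ge> 3" "t > 0" "AE w in N. 0 \<le> x n w" "integrable N (\<lambda>w. x n w ^ 4)"
  shows "nonneg_iid_array M N (x n) n (\<lambda>(i, j). X n i j) t"
proof unfold_locales
  show "x n \<in> borel_measurable N" using assms(1) by (intro x_meas) simp
  show "indep_vars (\<lambda>_. borel) (\<lambda>(i, j). X n i j) ({..<n} \<times> {..<n})" using assms(1) by (intro indep) simp
  show "distr M borel ((\<lambda>(i, j). X n i j) k) = distr N borel (x n)" if "k \<in> {..<n} \<times> {..<n}" for k
    using that assms(1) distr by auto
qed (use assms in auto)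

text \<open>\<open>x n\<close> and \<open>x 1\<close> agree only in law, so \<open>same\<close>
  transports each moment to \<open>x 1\<close>. All moments of the entries are then constants, and
  the conditions become comparisons of powers of \<open>n\<close> with logarithms.\<close>

lemma fixed_law_regular:
  assumes "fixed_law_case N x"
  obtains t C where "\<forall>\<^sub>F n in sequentially. regular_array M N (x n) n (\<lambda>(i, j). X n i j) (t n) C"
proof -
  note F = assms[unfolded fixed_law_case_def]
  have law: "distr N borel (x n) = distr N borel (x 1)" if "n \<ge> 1" for n
    using conjunct1[OF F] that by blast
  have x0: "AE w in N. 0 \<le> x n w" if "n \<ge> 1" for n
    using conjunct2[OF F] that by blast
  have x4: "integrable N (\<lambda>w. x n w ^ 4)" if "n \<ge> 1" for n
    using conjunct2[OF F] that by (simp add: power_even_abs)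
  have var: "N.variance (x 1) > 0" using conjunct2[OF F] by blast
  have same: "N.expectation (\<lambda>w. f (x n w)) = N.expectation (\<lambda>w. f (x 1 w))"
    if n: "n \<ge> 1" and f: "f \<in> borel_measurable borel" for n and f :: "real \<Rightarrow> real"
    using integral_distr[OF x_meas[OF n] f] integral_distr[OF x_meas[OF order_refl] f] law[OF n] by simp
  define m q v w K where "m = N.expectation (x 1)" and "q = N.expectation (\<lambda>w. (x 1 w)\<^sup>2)"
    and "v = N.expectation (\<lambda>w. (x 1 w - m)\<^sup>2)" and "w = N.expectation (\<lambda>w. (x 1 w - m) ^ 4)"
    and "K = N.expectation (\<lambda>w. x 1 w ^ 4)"
  have x1: "integrable N (x 1)"
    using N.integrable_power_of_fourth[OF x_meas x4, of 1 1] by simp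
  have m: "m > 0" unfolding m_def by (rule N.expectation_pos_if_variance_pos[OF x1 x0 var]) simp
  have v: "v > 0" using var by (simp add: v_def m_def)
  have K: "K \<ge> 0" unfolding K_def by (rule integral_nonneg_AE) simp
  have w: "w \<ge> 0" unfolding w_def by (rule integral_nonneg_AE) simp
  define C where "C = w / v\<^sup>2 + (8 * K + 8 * m ^ 4) / m ^ 4 + K\<^sup>2 / m ^ 4"
  have parts: "w / v\<^sup>2 \<ge> 0" "(8 * K + 8 * m ^ 4) / m ^ 4 \<ge> 0" "K\<^sup>2 / m ^ 4 \<ge> 0"
    using w K m by simp_all
  have C: "w / v\<^sup>2 \<le> C" "(8 * K + 8 * m ^ 4) / m ^ 4 \<le> C" "K\<^sup>2 / m ^ 4 \<le> C" "0 \<le> C"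
    unfolding C_def using parts by linarith+
  have C': "w \<le> C * v\<^sup>2" "8 * K + 8 * m ^ 4 \<le> C * m ^ 4" "K\<^sup>2 \<le> C * m ^ 4"
    using C v m by (simp_all add: pos_divide_le_eq)
  have "((\<lambda>n. q / sqrt (real n)) \<longlongrightarrow> 0) sequentially" by real_asymp
  then have 1: "\<forall>\<^sub>F n in sequentially. q / sqrt (real n) < m / 4096"
    by (rule order_tendstoD) (use m in simp)
  have "((\<lambda>n. 2 ^ 28 * q * ln (real n) / real n) \<longlongrightarrow> 0) sequentially" by real_asymp
  then have 2: "\<forall>\<^sub>F n in sequentially. 2 ^ 28 * q * ln (real n) / real n < m\<^sup>2"
    by (rule order_tendstoD) (use m in simp)
  have "((\<lambda>n. 2 ^ 28 * sqrt (real n) * ln (real n) / real n) \<longlongrightarrow> 0) sequentially" by real_asymp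
  then have 3: "\<forall>\<^sub>F n in sequentially. 2 ^ 28 * sqrt (real n) * ln (real n) / real n < m"
    by (rule order_tendstoD) (use m in simp)
  \<comment> \<open>Truncating at \<open>sqrt n\<close> leaves enough decay for the exponential bounds, while the fourth moment
    makes the variance of the excess \<open>O(1 / n)\<close>.\<close>
  have "\<forall>\<^sub>F n in sequentially. regular_array M N (x n) n (\<lambda>(i, j). X n i j) (sqrt (real n)) C"
    using 1 2 3 eventually_ge_at_top[of 3]
  proof eventually_elim
    case (elim n)
    then have n: "n \<ge> 1" "real n \<ge> 1" "real n > 0" by auto
    interpret P: nonneg_iid_array M N "x n" n "\<lambda>(i, j). X n i j" "sqrt (real n)"
      by (rule nonneg_array) (use elim n x0 x4 in auto)
    have Pm: "P.m = m" and Pq: "P.q = q"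
      unfolding P.m_def m_def P.q_def q_def using same[OF n(1), of "\<lambda>y. y"] same[OF n(1), of "\<lambda>y. y\<^sup>2"] by simp_all
    have Pv: "P.v = v" and Pw: "P.w = w"
      unfolding P.v_def v_def P.w_def w_def Pm
      using same[OF n(1), of "\<lambda>y. (y - m)\<^sup>2"] same[OF n(1), of "\<lambda>y. (y - m) ^ 4"] by simp_all
    have PK: "N.expectation (\<lambda>w. x n w ^ 4) = K" unfolding K_def using same[OF n(1), of "\<lambda>y. y ^ 4"] by simp
    show ?case
    proof unfold_locales
      show "0 < P.m" "0 < P.v" "0 \<le> C" using m v C by (simp_all add: Pm Pv)
      show "P.ez \<le> P.m / 4096" using P.ez_truncation_bound elim(1) unfolding Pm Pq by linarith
      show "2 ^ 28 * P.q * ln (real n) \<le> real n * P.m\<^sup>2"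
        using elim(2) n by (simp add: Pm Pq pos_divide_less_eq mult.commute)
      show "2 ^ 28 * sqrt (real n) * ln (real n) \<le> real n * P.m"
        using elim(3) n by (simp add: Pm pos_divide_less_eq mult.commute)
      have "w * 1 \<le> (C * v\<^sup>2) * real n" using C'(1) w n by (intro mult_mono) auto
      then show "P.w \<le> C * real n * P.v\<^sup>2" by (simp add: Pw Pv mult_ac)
      show "P.wz \<le> C * P.m ^ 4" using P.wz_bound C'(2) by (simp add: PK Pm)
      have "P.vz\<^sup>2 \<le> (K / real n)\<^sup>2"
        using P.vz_truncation_bound by (intro power_mono) (auto simp: PK)
      also have "\<dots> = K\<^sup>2 / (real n * real n)" by (simp add: power_divide power2_eq_square)
      also have "\<dots> \<le> (C * m ^ 4) / (1 * real n)"
        using C'(3) n C(4) m by (intro frac_le mult_right_mono) auto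
      finally show "P.vz\<^sup>2 \<le> C * P.m ^ 4 / real n" by (simp add: Pm)
    qed
  qed
  then show ?thesis by (rule that[of "\<lambda>n. sqrt (real n)"])
qed

text \<open>Entries are bounded by \<open>B\<close>, so truncation at \<open>B\<close> changes
  nothing almost surely and the excess moments vanish. First and second moments are
  \<open>p n\<close> times constants, and the variance is at most \<open>p n * q1\<close>; its
  growth therefore forces \<open>n * p n\<close> to outgrow \<open>ln n\<close>, which is what the
  two size conditions require.\<close>

lemma sparse_regular:
  assumes "sparse_case N x"
  obtains t C where "\<forall>\<^sub>F n in sequentially. regular_array M N (x n) n (\<lambda>(i, j). X n i j) (t n) C"
proof -
  from assms obtain eps :: "nat \<Rightarrow> 'b \<Rightarrow> real" and y :: "'b \<Rightarrow> real" and p :: "nat \<Rightarrow> real" and B0 where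
    x: "\<And>n w. n \<ge> 1 \<Longrightarrow> w \<in> space N \<Longrightarrow> x n w = eps n w * y w" and
    y_meas [measurable]: "y \<in> borel_measurable N" and y0: "AE w in N. 0 \<le> y w" and yB0: "AE w in N. y w \<le> B0" and
    p: "\<And>n. n \<ge> 1 \<Longrightarrow> 0 \<le> p n" "\<And>n. n \<ge> 1 \<Longrightarrow> p n \<le> 1" and
    eps_meas: "\<And>n. n \<ge> 1 \<Longrightarrow> eps n \<in> borel_measurable N" and
    eps_law: "\<And>n. n \<ge> 1 \<Longrightarrow> distr N borel (eps n) = distr (measure_pmf (bernoulli_pmf (p n))) borel of_bool" and
    ind: "\<And>n. n \<ge> 1 \<Longrightarrow> N.indep_var borel (eps n) borel y" and
    lim: "filterlim (\<lambda>n. real n * (std_dev N (x n))\<^sup>2 / ln (real n)) at_top sequentially"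
    unfolding sparse_case_def by blast
  define B where "B = max B0 1"
  have B: "B > 0" by (simp add: B_def)
  have yB: "AE w in N. \<bar>y w\<bar> \<le> B" using y0 yB0 by eventually_elim (simp add: B_def)
  have y_pow: "integrable N (\<lambda>w. y w ^ k)" for k
  proof (rule N.integrable_const_bound[where B = "B ^ k"])
    show "AE w in N. norm (y w ^ k) \<le> B ^ k"
      using yB by eventually_elim (simp add: power_abs power_mono)
  qed simp
  have eps01: "AE w in N. eps n w = 0 \<or> eps n w = 1" if n: "n \<ge> 1" for n
  proof -
    have S: "{z \<in> space borel. z = 0 \<or> z = (1::real)} \<in> sets borel" by measurable
    have "AE z in distr (measure_pmf (bernoulli_pmf (p n))) borel of_bool. z = 0 \<or> z = (1::real)"
      by (subst AE_distr_iff[OF _ S]) auto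
    then have "AE z in distr N borel (eps n). z = 0 \<or> z = (1::real)" by (simp only: eps_law[OF n])
    then show ?thesis using AE_distr_iff[OF eps_meas[OF n] S] by simp
  qed
  have eps_pow: "integrable N (\<lambda>w. eps n w ^ k)" if n: "n \<ge> 1" for n k
  proof (rule N.integrable_const_bound[where B = 1])
    show "AE w in N. norm (eps n w ^ k) \<le> 1"
      using eps01[OF n] by eventually_elim (auto simp: power_0_left)
  qed (use eps_meas[OF n] in simp)
  have eps_mean: "N.expectation (\<lambda>w. eps n w ^ k) = p n" if n: "n \<ge> 1" and k: "k \<ge> 1" for n k
  proof -
    have f: "(\<lambda>z. z ^ k) \<in> borel_measurable (borel :: real measure)" by simp
    have "N.expectation (\<lambda>w. eps n w ^ k) = integral\<^sup>L (distr N borel (eps n)) (\<lambda>z. z ^ k)"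
      by (rule integral_distr[OF eps_meas[OF n] f, symmetric])
    also have "\<dots> = measure_pmf.expectation (bernoulli_pmf (p n)) (\<lambda>b. of_bool b ^ k)"
      unfolding eps_law[OF n] by (rule integral_distr[OF _ f]) simp
    also have "\<dots> = p n" using p[OF n] k by simp
    finally show ?thesis .
  qed
  have x_pow: "N.expectation (\<lambda>w. x n w ^ k) = p n * N.expectation (\<lambda>w. y w ^ k)" if n: "n \<ge> 1" and k: "k \<ge> 1" for n k
  proof -
    have "N.expectation (\<lambda>w. x n w ^ k) = N.expectation (\<lambda>w. eps n w ^ k * y w ^ k)"
      using x[OF n] by (intro Bochner_Integration.integral_cong) (auto simp: power_mult_distrib)
    also have "\<dots> = p n * N.expectation (\<lambda>w. y w ^ k)"
      using N.indep_var_powers(2)[OF ind[OF n] eps_pow[OF n] y_pow] eps_mean[OF n k] by simp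
    finally show ?thesis .
  qed
  have xB: "AE w in N. 0 \<le> x n w \<and> x n w \<le> B" if n: "n \<ge> 1" for n
    using eps01[OF n] y0 yB AE_space
  proof eventually_elim
    case (elim w) then show ?case using x[OF n, of w] B by auto
  qed
  have x_int: "integrable N (\<lambda>w. x n w ^ k)" if n: "n \<ge> 1" for n k
  proof (rule N.integrable_const_bound[where B = "B ^ k"])
    show "AE w in N. norm (x n w ^ k) \<le> B ^ k"
      using xB[OF n] by eventually_elim (simp add: power_mono)
  qed (use x_meas[OF n] in simp)
  define m1 q1 where "m1 = N.expectation y" and "q1 = N.expectation (\<lambda>w. (y w)\<^sup>2)"
  have large: "\<forall>\<^sub>F n in sequentially. A * ln (real n) \<le> real n * N.variance (x n)" for A
  proof -
    have "\<forall>\<^sub>F n in sequentially. A \<le> real n * (std_dev N (x n))\<^sup>2 / ln (real n)"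
      using lim by (simp add: filterlim_at_top)
    then show ?thesis using eventually_ge_at_top[of 3]
    proof eventually_elim
      case (elim n)
      have "(std_dev N (x n))\<^sup>2 = N.variance (x n)"
        unfolding std_dev_def by (simp add: N.variance_positive)
      moreover have "ln (real n) > 0" using elim(2) by simp
      ultimately show ?case using elim(1) by (simp add: pos_le_divide_eq)
    qed
  qed
  have var_pos: "N.variance (x n) > 0" if "1 * ln (real n) \<le> real n * N.variance (x n)" "n \<ge> 3" for n
  proof -
    have "0 < ln (real n)" using that(2) by simp
    then have "0 < real n * N.variance (x n)" using that(1) by linarith
    then show ?thesis using that(2) by (simp add: zero_less_mult_iff)
  qed
  have var_le: "N.variance (x n) \<le> p n * q1" if n: "n \<ge> 1" for n
    using N.variance_eq[of "x n"] x_int[OF n, of 1] x_int[OF n, of 2] x_pow[OF n, of 2] by (simp add: q1_def)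
  \<comment> \<open>Positivity of the moments of \<open>y\<close> is read off from a single
    \<open>n\<close> at which \<open>x n\<close> has positive variance.\<close>
  have pos: "m1 > 0" "q1 > 0"
  proof -
    obtain n where n: "1 * ln (real n) \<le> real n * N.variance (x n)" "n \<ge> 3"
      using eventually_happens[OF eventually_conj[OF large[of 1] eventually_ge_at_top[of 3]]] by auto
    then have n1: "n \<ge> 1" by simp
    note v = var_pos[OF n]
    have "N.expectation (x n) > 0"
    proof (rule N.expectation_pos_if_variance_pos[OF _ _ v])
      show "integrable N (x n)" using x_int[OF n1, of 1] by simp
      show "AE w in N. 0 \<le> x n w" using xB[OF n1] by eventually_elim simp
    qed
    then have "0 < p n * m1" using x_pow[OF n1, of 1] by (simp add: m1_def)
    then show "m1 > 0" using p(1)[OF n1] by (simp add: zero_less_mult_iff)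
    have "0 < p n * q1" using v var_le[OF n1] by linarith
    then show "q1 > 0" using p(1)[OF n1] by (simp add: zero_less_mult_iff)
  qed
  have "\<forall>\<^sub>F n in sequentially. regular_array M N (x n) n (\<lambda>(i, j). X n i j) B (B\<^sup>2)"
    \<comment> \<open>The last two constants become \<open>mean_sq_large\<close> and
      \<open>mean_large\<close> once the variance is replaced by its bound
      \<open>p n * q1\<close>.\<close>
    using large[of 1] large[of "2 ^ 28 * q1\<^sup>2 / m1\<^sup>2"] large[of "2 ^ 28 * B * q1 / m1"] eventually_ge_at_top[of 3]
  proof eventually_elim
    case (elim n)
    then have n: "n \<ge> 1" "real n \<ge> 1" "real n > 0" and ln: "ln (real n) \<ge> 0" by auto
    note vpos = var_pos[OF elim(1,4)]
    have x0: "AE w in N. 0 \<le> x n w" using xB[OF n(1)] by eventually_elim simp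
    interpret P: nonneg_iid_array M N "x n" n "\<lambda>(i, j). X n i j" B
      by (rule nonneg_array[OF elim(4) B x0 x_int[OF n(1)]])
    have Pm: "P.m = p n * m1" and Pq: "P.q = p n * q1"
      using x_pow[OF n(1), of 1] x_pow[OF n(1), of 2] by (simp_all add: P.m_def P.q_def m1_def q1_def)
    have Pv: "P.v = N.variance (x n)" by (simp add: P.v_def P.m_def)
    have v_le: "real n * P.v \<le> real n * (p n * q1)"
      unfolding Pv using var_le[OF n(1)] by (intro mult_left_mono) auto
    have Pm0: "P.m > 0"
      unfolding P.m_def
      by (rule N.expectation_pos_if_variance_pos[OF _ x0 vpos]) (use x_int[OF n(1), of 1] in simp)
    have p0: "p n > 0" using Pm0 pos p(1)[OF n(1)] by (simp add: Pm zero_less_mult_iff)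
    have excess0: "AE w in N. P.excess (x n w) = 0"
      using xB[OF n(1)] by eventually_elim (simp add: P.excess_def)
    have ez: "P.ez = 0"
      unfolding P.ez_def by (rule integral_eq_zero_AE[OF excess0])
    have vz: "P.vz = 0"
      unfolding P.vz_def ez by (rule integral_eq_zero_AE) (use excess0 in eventually_elim, simp)
    have wz: "P.wz = 0"
      unfolding P.wz_def ez by (rule integral_eq_zero_AE) (use excess0 in eventually_elim, simp)
    have m_le: "P.m \<le> B"
    proof -
      have "P.m \<le> N.expectation (\<lambda>_. B)"
        unfolding P.m_def
      proof (rule integral_mono_AE)
        show "AE w in N. x n w \<le> B" using xB[OF n(1)] by eventually_elim simp
      qed (use x_int[OF n(1), of 1] in simp_all)
      then show ?thesis by (simp add: N.prob_space)
    qed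
    have w_le: "P.w \<le> B\<^sup>2 * P.v"
    proof -
      have i: "integrable N (\<lambda>w. (x n w - P.m) ^ 4)"
      proof (rule P.integrable_fourth_bound[where a = "\<bar>P.m\<bar>"])
        show "AE w in N. \<bar>x n w - P.m\<bar> \<le> \<bar>x n w\<bar> + \<bar>P.m\<bar>" by simp
      qed (use x_meas[OF n(1)] in simp)
      have i2: "integrable N (\<lambda>w. (x n w - P.m)\<^sup>2)"
        by (rule N.integrable_power_of_fourth[OF _ i]) (use x_meas[OF n(1)] in simp_all)
      have "P.w \<le> N.expectation (\<lambda>w. B\<^sup>2 * (x n w - P.m)\<^sup>2)"
        unfolding P.w_def
      proof (rule integral_mono_AE[OF i])
        show "AE w in N. (x n w - P.m) ^ 4 \<le> B\<^sup>2 * (x n w - P.m)\<^sup>2"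
          using xB[OF n(1)]
        proof eventually_elim
          case (elim w)
          have "\<bar>x n w - P.m\<bar> \<le> B" using elim Pm0 m_le by linarith
          then have "\<bar>x n w - P.m\<bar>\<^sup>2 \<le> B\<^sup>2" by (intro power_mono) auto
          then have "(x n w - P.m)\<^sup>2 * (x n w - P.m)\<^sup>2 \<le> B\<^sup>2 * (x n w - P.m)\<^sup>2"
            by (intro mult_right_mono) auto
          then show ?case by (simp add: power2_eq_square power4_eq_xxxx mult.assoc)
        qed
      qed (use i2 in simp)
      then show ?thesis by (simp add: P.v_def)
    qed
    show ?case
    proof unfold_locales
      show "0 < P.m" by (rule Pm0)
      show "0 < P.v" using vpos by (simp add: Pv)
      show "P.ez \<le> P.m / 4096" "P.wz \<le> B\<^sup>2 * P.m ^ 4" "P.vz\<^sup>2 \<le> B\<^sup>2 * P.m ^ 4 / real n"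
        using Pm0 by (simp_all add: ez wz vz)
      show "0 \<le> B\<^sup>2" by simp
      have "2 ^ 28 * q1\<^sup>2 / m1\<^sup>2 * ln (real n) \<le> real n * (p n * q1)"
        using elim(2) v_le unfolding Pv by linarith
      then have "(2 ^ 28 * q1\<^sup>2 / m1\<^sup>2 * ln (real n)) * (p n * m1\<^sup>2 / q1) \<le> (real n * (p n * q1)) * (p n * m1\<^sup>2 / q1)"
        using p0 pos by (intro mult_right_mono) auto
      then show "2 ^ 28 * P.q * ln (real n) \<le> real n * P.m\<^sup>2"
        using pos by (simp add: Pm Pq power2_eq_square mult_ac)
      have "2 ^ 28 * B * q1 / m1 * ln (real n) \<le> real n * (p n * q1)"
        using elim(3) v_le unfolding Pv by linarith
      then have "(2 ^ 28 * B * q1 / m1 * ln (real n)) * (m1 / q1) \<le> (real n * (p n * q1)) * (m1 / q1)"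
        using pos by (intro mult_right_mono) auto
      then show "2 ^ 28 * B * ln (real n) \<le> real n * P.m"
        using pos by (simp add: Pm mult_ac)
      have ln1: "1 \<le> ln (real n)"
      proof -
        have "exp 1 \<le> real n" using exp_le elim(4) by linarith
        then show ?thesis using n by (simp add: ln_ge_iff)
      qed
      \<comment> \<open>The fourth moment is bounded by \<open>B^2\<close> times only the first
        power of the variance. The factor \<open>n\<close> in \<open>w_le\<close> supplies the
        missing power, since \<open>n * v >= 1\<close>.\<close>
      have "1 \<le> real n * P.v" using elim(1) ln1 unfolding Pv by linarith
      then have "(B\<^sup>2 * P.v) * 1 \<le> (B\<^sup>2 * P.v) * (real n * P.v)"
        using vpos Pv by (intro mult_left_mono) auto
      then show "P.w \<le> B\<^sup>2 * real n * P.v\<^sup>2" using w_le by (simp add: power2_eq_square mult_ac)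
    qed
  qed
  then show ?thesis by (rule that[of "\<lambda>_. B"])
qed

end

theorem theorem1p7:
  fixes M :: "'a measure" and N :: "'b measure"
    and x :: "nat \<Rightarrow> 'b \<Rightarrow> real"
    and X :: "nat \<Rightarrow> nat \<Rightarrow> nat \<Rightarrow> 'a \<Rightarrow> real"
    and L :: "nat \<Rightarrow> 'a \<Rightarrow> real mat"
    and m \<sigma> :: "nat \<Rightarrow> real"
  assumes "prob_space M" and "prob_space N"
    and "\<And>n. n \<ge> 1 \<Longrightarrow> x n \<in> borel_measurable N"
    and "\<And>n. n \<ge> 1 \<Longrightarrow>
           prob_space.indep_vars M (\<lambda>_. borel) (\<lambda>(i, j). X n i j) ({..<n} \<times> {..<n})"
    and "\<And>n i j. n \<ge> 1 \<Longrightarrow> i < n \<Longrightarrow> j < n \<Longrightarrow>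
           distr M borel (X n i j) = distr N borel (x n)"
    and "\<And>n. m n = mean N (x n)"
    and "\<And>n. \<sigma> n = std_dev N (x n)"
    and "fixed_law_case N x \<or> sparse_case N x"
    and "\<And>n \<omega>. L n \<omega> = markov_generator (mat n n (\<lambda>(i, j). X n i j \<omega>))"
  shows "\<exists>f g :: nat \<Rightarrow> real.
      f \<in> O(\<lambda>n. \<sigma> n / m n * sqrt (ln (real n) / real n)) \<and>
      g \<in> O(\<lambda>n. sqrt (\<sigma> n) / m n * (ln (real n) / real n powr (3 / 4))) \<and>
      (AE \<omega> in M. \<forall>\<^sub>F n in sequentially.
         irreducible_generator (L n \<omega>) \<and>
         (\<exists>!P. is_invariant_measure (L n \<omega>) P) \<and>
         tv_norm (invariant_measure (L n \<omega>) - uniform_vec n) \<le> f n + g n)"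
proof -
  interpret iid_arrays M N x X
    by (intro iid_arrays.intro iid_arrays_axioms.intro assms)
  obtain t C where "\<forall>\<^sub>F n in sequentially. regular_array M N (x n) n (\<lambda>(i, j). X n i j) (t n) C"
    using assms(8) fixed_law_regular sparse_regular by blast
  from regular_arrays_conclusion[OF this]
  have "AE \<omega> in M. \<forall>\<^sub>F n in sequentially. irreducible_generator (L n \<omega>) \<and>
     (\<exists>!P. is_invariant_measure (L n \<omega>) P) \<and>
     tv_norm (invariant_measure (L n \<omega>) - uniform_vec n) \<le> 4096 * (\<sigma> n / m n * sqrt (ln (real n) / real n)) + 0"
    unfolding assms(6,7,9) by simp
  moreover have "(\<lambda>n. 4096 * (\<sigma> n / m n * sqrt (ln (real n) / real n))) \<in> O(\<lambda>n. \<sigma> n / m n * sqrt (ln (real n) / real n))"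
    by (intro bigoI[of _ 4096] always_eventually allI) (simp only: norm_mult, simp)
  moreover have "(\<lambda>n. 0) \<in> O(\<lambda>n. sqrt (\<sigma> n) / m n * (ln (real n) / real n powr (3 / 4)))" by simp
  ultimately show ?thesis
    by (intro exI[of _ "\<lambda>n. 4096 * (\<sigma> n / m n * sqrt (ln (real n) / real n))"] exI[of _ "\<lambda>_. 0"] conjI)
qed

end
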